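(* Let $G,H,K$ be groups, let $d\colon G\to H$ be a derivation relative to some action of $G$ on $H$ by automorphisms, and let $d'\colon H\rtimes G\to K$ be a derivation relative to some action of $H\rtimes G$ on $K$ by automorphisms. Then the complexity of the derivation $d'\ast d=(d'\circ s_d,d)\colon G\to K\rtimes H$ satisfies $$\mathrm{tc}(d'\ast d)\ge\max\{\mathrm{tc}(d),\mathrm{tc}(d')\}.$$
   Context: All groups are discrete. When a group $G$ (written multiplicatively) acts by automorphisms on a group $K$ (written additively, even though not necessarily abelian), $(g,k)\mapsto g\cdot k$, the semi-direct product $K\rtimes G$ is the set $K\times G$ with $(k,g)(k',g')=(k+g\cdot k',gg')$, with projection $p\colon K\rtimes G\to G$, $p(k,g)=g$. A derivation is a function $d\colon G\to K$ with $d(gh)=d(g)+g\cdot d(h)$; it determines the splitting $s_d\colon G\to K\rtimes G$, $s_d(g)=(d(g),g)$, of $p$. In $K\rtimes(H\rtimes G)$, the subgroups $H$ and $G$ of $H\rtimes G$ act on $K$, and $G$ acts on $K\rtimes H$ by conjugation (that is, $g\cdot(k,h)=(g\cdot k,g\cdot h)$), so that $K\rtimes(H\rtimes G)\cong(K\rtimes H)\rtimes G$ via $(k,(h,g))\mapsto((k,h),g)$. The function $d'\ast d\colon G\to K\rtimes H$, $g\mapsto(d'(s_d(g)),d(g))$, is a derivation relative to this action, and $s_{d'\ast d}=s_{d'}\circ s_d$ under the isomorphism $K\rtimes(H\rtimes G)\cong(K\rtimes H)\rtimes G$, $(k,(h,g))\mapsto((k,h),g)$. A functorial classifying space construction gives,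 for a derivation $d\colon G\to K$, a fibration $Bp\colon B(K\rtimes G)\to BG$ with fibre $BK$ and section $B(s_d)$. For a fibration $q\colon E\to Y$, the sectional category $\mathrm{secat}(q)$ is the minimal $n$ such that $Y$ has an open cover $U_0,\dots,U_n$ with each $U_i$ admitting a section $U_i\to E$ of $q$ ($\infty$ if there is no such $n$). For a fibration $q\colon X\to B$ with section $s\colon B\to X$, let $P_BX=\{\alpha\colon I\to X \text{ continuous}\mid q\circ\alpha \text{ constant},\ \alpha(0)=s(q(\alpha(0)))\}$ and $\mathrm{ev}_1\colon P_BX\to X$, $\alpha\mapsto\alpha(1)$. The complexity of $d$ is the $BG$-parametrized LS-category of $B(K\rtimes G)$ with respect to the section $B(s_d)$ of $Bp$, that is, $$\mathrm{tc}(d):=\mathrm{cat}_{BG}(B(K\rtimes G))=\mathrm{secat}\big(\mathrm{ev}_1\colon P_{BG}B(K\rtimes G)\to B(K\rtimes G)\big).$$ *)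

theory Defs
  imports
    "HOL-Algebra.Bij"
    "HOL-Homology.Simplices"
    "HOL-Library.Extended_Nat"
begin

section \<open>Derivations and semi-direct products\<close>

text \<open>
  All groups are written multiplicatively, including the coefficient group \<open>K\<close> of a derivation.
  An action of \<open>G\<close> on \<open>K\<close> by automorphisms is an element of \<open>hom G (AutoGroup K)\<close>.
\<close>

definition semidirect ::
    "'k monoid \<Rightarrow> 'g monoid \<Rightarrow> ('g \<Rightarrow> 'k \<Rightarrow> 'k) \<Rightarrow> ('k \<times> 'g) monoid" where
  "semidirect K G a =
     \<lparr>carrier = carrier K \<times> carrier G,
      mult = \<lambda>(k, g) (k', g'). (k \<otimes>\<^bsub>K\<^esub> a g k', g \<otimes>\<^bsub>G\<^esub> g'),
      one = (\<one>\<^bsub>K\<^esub>, \<one>\<^bsub>G\<^esub>)\<rparr>"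

definition derivation ::
    "'g monoid \<Rightarrow> 'k monoid \<Rightarrow> ('g \<Rightarrow> 'k \<Rightarrow> 'k) \<Rightarrow> ('g \<Rightarrow> 'k) \<Rightarrow> bool" where
  "derivation G K a d \<longleftrightarrow>
     d \<in> carrier G \<rightarrow> carrier K \<and>
     (\<forall>g\<in>carrier G. \<forall>h\<in>carrier G. d (g \<otimes>\<^bsub>G\<^esub> h) = d g \<otimes>\<^bsub>K\<^esub> a g (d h))"

definition splitting :: "('g \<Rightarrow> 'k) \<Rightarrow> 'g \<Rightarrow> 'k \<times> 'g" where
  "splitting d g = (d g, g)"

definition restrict_action_left ::
    "'g monoid \<Rightarrow> ('h \<times> 'g \<Rightarrow> 'k \<Rightarrow> 'k) \<Rightarrow> 'h \<Rightarrow> 'k \<Rightarrow> 'k" where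
  "restrict_action_left G b h = b (h, \<one>\<^bsub>G\<^esub>)"

text \<open>
  The conjugation action of \<open>G\<close> on \<open>K \<rtimes> H\<close> inside \<open>K \<rtimes> (H \<rtimes> G)\<close>.  Automorphisms in
  \<open>AutoGroup\<close> are extensional, whence the restriction to the carrier.
\<close>

definition conj_action ::
    "'h monoid \<Rightarrow> 'k monoid \<Rightarrow> ('g \<Rightarrow> 'h \<Rightarrow> 'h) \<Rightarrow> ('h \<times> 'g \<Rightarrow> 'k \<Rightarrow> 'k)
      \<Rightarrow> 'g \<Rightarrow> 'k \<times> 'h \<Rightarrow> 'k \<times> 'h" where
  "conj_action H K a b g =
     (\<lambda>(k, h) \<in> carrier K \<times> carrier H. (b (\<one>\<^bsub>H\<^esub>, g) k, a g h))"

definition derivation_star ::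
    "('h \<times> 'g \<Rightarrow> 'k) \<Rightarrow> ('g \<Rightarrow> 'h) \<Rightarrow> 'g \<Rightarrow> 'k \<times> 'h" where
  "derivation_star d' d g = (d' (splitting d g), d g)"


section \<open>The classifying space of a discrete group\<close>

text \<open>
  The functorial construction used is the geometric realization of the nerve.  An \<open>n\<close>-simplex of
  the nerve is a functor from the poset \<open>[n]\<close> to the one-object category \<open>G\<close>: the family of the
  images \<open>\<sigma> (i, j)\<close> of the arrows \<open>i \<le> j\<close>.  In terms of the bar construction it is
  \<open>[\<sigma> (0, 1) | \<dots> | \<sigma> (n - 1, n)]\<close>.
\<close>

definition arrows :: "nat \<Rightarrow> (nat \<times> nat) set" where
  "arrows n = {(i, j). i \<le> j \<and> j \<le> n}"

definition nerve :: "'g monoid \<Rightarrow> nat \<Rightarrow> (nat \<times> nat \<Rightarrow> 'g) set" where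
  "nerve G n =
     {\<sigma> \<in> arrows n \<rightarrow>\<^sub>E carrier G.
        (\<forall>i\<le>n. \<sigma> (i, i) = \<one>\<^bsub>G\<^esub>) \<and>
        (\<forall>i j k. i \<le> j \<longrightarrow> j \<le> k \<longrightarrow> k \<le> n \<longrightarrow> \<sigma> (i, j) \<otimes>\<^bsub>G\<^esub> \<sigma> (j, k) = \<sigma> (i, k))}"

definition order_maps :: "nat \<Rightarrow> nat \<Rightarrow> (nat \<Rightarrow> nat) set" where
  "order_maps m n = {\<theta> \<in> {..m} \<rightarrow> {..n}. mono_on {..m} \<theta>}"

definition nerve_pullback ::
    "nat \<Rightarrow> (nat \<Rightarrow> nat) \<Rightarrow> (nat \<times> nat \<Rightarrow> 'g) \<Rightarrow> nat \<times> nat \<Rightarrow> 'g" where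
  "nerve_pullback m \<theta> \<sigma> = (\<lambda>(i, j) \<in> arrows m. \<sigma> (\<theta> i, \<theta> j))"

definition simplex_push :: "nat \<Rightarrow> (nat \<Rightarrow> nat) \<Rightarrow> (nat \<Rightarrow> real) \<Rightarrow> nat \<Rightarrow> real" where
  "simplex_push m \<theta> t = (\<lambda>j. \<Sum>i | i \<le> m \<and> \<theta> i = j. t i)"

type_synonym 'g cell_point = "nat \<times> (nat \<times> nat \<Rightarrow> 'g) \<times> (nat \<Rightarrow> real)"

definition cell_points :: "'g monoid \<Rightarrow> 'g cell_point set" where
  "cell_points G = (SIGMA n : UNIV. nerve G n \<times> standard_simplex n)"

definition glue :: "'g monoid \<Rightarrow> 'g cell_point rel" where
  "glue G =
     {((m, nerve_pullback m \<theta> \<sigma>, t), (n, \<sigma>, simplex_push m \<theta> t)) | m n \<theta> \<sigma> t.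
        \<theta> \<in> order_maps m n \<and> \<sigma> \<in> nerve G n \<and> t \<in> standard_simplex m}"

definition glue_equiv :: "'g monoid \<Rightarrow> 'g cell_point rel" where
  "glue_equiv G = (glue G \<union> (glue G)\<inverse>)\<^sup>*"

text \<open>
  The quotient topology of the disjoint union of one standard simplex for each simplex of the
  nerve, that is, the weak (CW) topology.
\<close>

definition classifying_space :: "'g monoid \<Rightarrow> 'g cell_point set topology" where
  "classifying_space G = topology (\<lambda>U.
     U \<subseteq> cell_points G // glue_equiv G \<and>
     (\<forall>n. \<forall>\<sigma>\<in>nerve G n.
        openin (subtopology (powertop_real UNIV) (standard_simplex n))
          {t \<in> standard_simplex n. glue_equiv G `` {(n, \<sigma>, t)} \<in> U}))"

lemma istopology_classifying_space:
  "istopology (\<lambda>U.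
     U \<subseteq> cell_points G // glue_equiv G \<and>
     (\<forall>n. \<forall>\<sigma>\<in>nerve G n.
        openin (subtopology (powertop_real UNIV) (standard_simplex n))
          {t \<in> standard_simplex n. glue_equiv G `` {(n, \<sigma>, t)} \<in> U}))"
  (is "istopology ?P")
  unfolding istopology_def
proof (rule conjI; rule allI; (rule allI)?; rule impI; (rule impI)?)
  fix S T assume S: "?P S" and T: "?P T"
  have "{t \<in> standard_simplex n. glue_equiv G `` {(n, \<sigma>, t)} \<in> S \<inter> T}
      = {t \<in> standard_simplex n. glue_equiv G `` {(n, \<sigma>, t)} \<in> S} \<inter>
        {t \<in> standard_simplex n. glue_equiv G `` {(n, \<sigma>, t)} \<in> T}" for n \<sigma>
    by auto
  with S T show "?P (S \<inter> T)" by auto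
next
  fix \<U> assume \<U>: "\<forall>S\<in>\<U>. ?P S"
  have "{t \<in> standard_simplex n. glue_equiv G `` {(n, \<sigma>, t)} \<in> \<Union>\<U>}
      = (\<Union>S\<in>\<U>. {t \<in> standard_simplex n. glue_equiv G `` {(n, \<sigma>, t)} \<in> S})" for n \<sigma>
    by auto
  with \<U> show "?P (\<Union>\<U>)" by auto
qed

text \<open>
  The map induced by a homomorphism \<open>\<phi> \<in> hom G G'\<close>.  All representatives \<open>(n, \<sigma>, t)\<close> of a point
  have \<open>glue_equiv G'\<close>-equivalent images \<open>(n, \<phi> \<circ> \<sigma>, t)\<close>, so that the image of the
  set of representatives under \<open>glue_equiv G'\<close> is a single class.
\<close>

definition classifying_map ::
    "'h monoid \<Rightarrow> ('g \<Rightarrow> 'h) \<Rightarrow> 'g cell_point set \<Rightarrow> 'h cell_point set" where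
  "classifying_map G' \<phi> x =
     glue_equiv G' `` ((\<lambda>(n, \<sigma>, t). (n, (\<lambda>e \<in> arrows n. \<phi> (\<sigma> e)), t)) ` x)"


section \<open>Sectional category and complexity\<close>

definition secat :: "'e topology \<Rightarrow> 'y topology \<Rightarrow> ('e \<Rightarrow> 'y) \<Rightarrow> enat" where
  "secat E Y q = Inf {enat n | n. \<exists>U s.
     (\<Union>i\<le>n. U i) = topspace Y \<and>
     (\<forall>i\<le>n. openin Y (U i) \<and>
        continuous_map (subtopology Y (U i)) E (s i) \<and>
        (\<forall>y\<in>U i. q (s i y) = y))}"

text \<open>
  The space of continuous maps; they are represented by functions that are \<open>undefined\<close> outside
  the domain space.
\<close>

definition compact_open_topology :: "'a topology \<Rightarrow> 'b topology \<Rightarrow> ('a \<Rightarrow> 'b) topology" where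
  "compact_open_topology X Y = topology_generated_by
     {{f \<in> extensional (topspace X). continuous_map X Y f \<and> f ` C \<subseteq> U} | C U.
        compactin X C \<and> openin Y U}"

definition fibrewise_path_space ::
    "'x topology \<Rightarrow> ('x \<Rightarrow> 'b) \<Rightarrow> ('b \<Rightarrow> 'x) \<Rightarrow> (real \<Rightarrow> 'x) topology" where
  "fibrewise_path_space X q s =
     subtopology (compact_open_topology (top_of_set {0..1}) X)
       {\<alpha>. (\<forall>u\<in>{0..1}. q (\<alpha> u) = q (\<alpha> 0)) \<and> \<alpha> 0 = s (q (\<alpha> 0))}"

definition parametrized_cat ::
    "'x topology \<Rightarrow> ('x \<Rightarrow> 'b) \<Rightarrow> ('b \<Rightarrow> 'x) \<Rightarrow> enat" where
  "parametrized_cat X q s = secat (fibrewise_path_space X q s) X (\<lambda>\<alpha>. \<alpha> 1)"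

definition tc ::
    "'g monoid \<Rightarrow> 'k monoid \<Rightarrow> ('g \<Rightarrow> 'k \<Rightarrow> 'k) \<Rightarrow> ('g \<Rightarrow> 'k) \<Rightarrow> enat" where
  "tc G K a d =
     parametrized_cat (classifying_space (semidirect K G a))
       (classifying_map G snd) (classifying_map (semidirect K G a) (splitting d))"

end

theory Submission
  imports Defs "HOL-Analysis.Lebesgue_Measure" "HOL-Analysis.Abstract_Topological_Spaces"
begin

text \<open>
  Only algebra is left once the complexity is expressed through the universal bundle.

  Lifted to the total space \<open>EG\<close> of the universal bundle, a point of \<open>BG\<close> is a step function
  \<open>[0, 1) \<rightarrow> G\<close>: the point with barycentric coordinates \<open>t\<close> in the simplex with vertices \<open>v 0, \<dots>, v n\<close>
  takes the value \<open>v j\<close> on the \<open>j\<close>-th of consecutive intervals of lengths \<open>t 0, \<dots>, t n\<close>.  Two step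
  functions lie over the same point of \<open>BG\<close> if and only if they differ by a left translation
  (\<open>realize_eq_iff\<close>).  The weak topology of \<open>BG\<close> is finer than the one given by the distance
  \<open>step_dist f h\<close>, the length of the set where \<open>f\<close> and \<open>h\<close> differ.  A proper translate of \<open>f\<close> differs
  from \<open>f\<close> everywhere, hence has distance \<open>1\<close> from it.  This is enough for existence and
  uniqueness of lifts of paths and for stability of their starting points under small perturbations
  (\<open>path_lift_exists\<close>, \<open>lift_nearby\<close>).

  Let \<open>p\<close> be a homomorphism from \<open>G\<close> to \<open>Q\<close>, split by \<open>s\<close>, and \<open>\<rho> = s \<circ> p\<close>.  A section of the
  evaluation over an open set \<open>U\<close> is a homotopy over \<open>BQ\<close> from \<open>B\<rho>\<close> to the inclusion of \<open>U\<close>.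
  Its path to the point below \<open>f\<close>, lifted so that it ends at \<open>f\<close>, starts at \<open>\<gamma>(f) \<rho>(f)\<close> for a unique
  \<open>\<gamma>(f)\<close> in the kernel of \<open>p\<close>.  The function \<open>\<gamma>\<close> is locally constant and satisfies
  \<open>\<gamma>(g f) = g \<gamma>(f) \<rho>(g)\<inverse>\<close>.  Conversely, from such a \<open>\<gamma>\<close> one obtains a homotopy: at time \<open>\<tau>\<close> take the
  step function that is \<open>f\<close> on \<open>[0, \<tau>)\<close> and \<open>\<gamma>(f) \<rho>(f)\<close> on \<open>[\<tau>, 1)\<close>.  So the parametrized category is
  the least \<open>n\<close> such that \<open>BG\<close> is covered by \<open>n + 1\<close> open sets that carry a function \<open>\<gamma>\<close>
  (\<open>parametrized_cat_eq_Inf\<close>).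

  Now let \<open>L = H \<rtimes> G\<close> and \<open>X = K \<rtimes> L\<close>, which is isomorphic to \<open>(K \<rtimes> H) \<rtimes> G\<close>, and let \<open>\<gamma>\<close> be such a
  function for the projection of \<open>X\<close> to \<open>G\<close>, split by the composition of the splittings of \<open>d'\<close> and
  \<open>d\<close>.  Restricting \<open>\<gamma>\<close> along the splitting of \<open>d'\<close> and projecting its values to \<open>L\<close> gives a
  function for \<open>d\<close> (\<open>parametrized_cat_retract_le\<close>).  With \<open>\<rho>\<close> the idempotent of \<open>X\<close> that belongs to \<open>d'\<close>,
  the function \<open>f \<mapsto> \<gamma>(f) \<rho>(\<gamma>(f))\<inverse>\<close> serves for \<open>d'\<close> (\<open>parametrized_cat_tower_le\<close>).  In both cases the
  number of open sets is unchanged, and this gives the two inequalities.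
\<close>

section \<open>Points of a simplex as partitions of the unit interval\<close>

text \<open>
  A point \<open>t\<close> of a standard simplex cuts \<open>[0, 1)\<close> into consecutive intervals of lengths
  \<open>t 0, t 1, \<dots>\<close>; the \<open>j\<close>-th of them starts at \<open>breakpoint t j\<close>, and \<open>step_index t u\<close> is the index of
  the one that contains \<open>u\<close>.  Vanishing coordinates give empty intervals, whose indices do not
  occur.
\<close>

definition breakpoint :: "(nat \<Rightarrow> real) \<Rightarrow> nat \<Rightarrow> real" where
  "breakpoint t j = (\<Sum>i<j. t i)"

definition step_index :: "(nat \<Rightarrow> real) \<Rightarrow> real \<Rightarrow> nat" where
  "step_index t u = (LEAST j. u < breakpoint t (Suc j))"

lemma breakpoint_0 [simp]: "breakpoint t 0 = 0"
  by (simp add: breakpoint_def)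

lemma breakpoint_Suc: "breakpoint t (Suc j) = breakpoint t j + t j"
  by (simp add: breakpoint_def)

lemma breakpoint_eqD:
  assumes "\<And>j. breakpoint t j = breakpoint t' j" shows "t = t'"
proof
  fix j show "t j = t' j"
    using assms[of j] assms[of "Suc j"] by (simp add: breakpoint_Suc)
qed

lemma breakpoint_mono:
  assumes "t \<in> standard_simplex n" "i \<le> j"
  shows "breakpoint t i \<le> breakpoint t j"
  unfolding breakpoint_def using assms
  by (intro sum_mono2) (auto simp: standard_simplex_def)

lemma breakpoint_top:
  assumes "t \<in> standard_simplex n" "n < j"
  shows "breakpoint t j = 1"
proof -
  have "(\<Sum>i<j. t i) = (\<Sum>i\<le>n. t i)"
    using assms by (intro sum.mono_neutral_right) (auto simp: standard_simplex_def)
  then show ?thesis using assms by (simp add: breakpoint_def standard_simplex_def)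
qed

lemma breakpoint_bounds:
  assumes "t \<in> standard_simplex n"
  shows "0 \<le> breakpoint t j" "breakpoint t j \<le> 1"
proof -
  show "0 \<le> breakpoint t j" using breakpoint_mono[OF assms, of 0 j] by simp
  show "breakpoint t j \<le> 1"
    using breakpoint_mono[OF assms, of j "j + Suc n"] breakpoint_top[OF assms, of "j + Suc n"] by simp
qed

lemma standard_simplexI:
  assumes "\<And>i. 0 \<le> t i" "\<And>i. n < i \<Longrightarrow> t i = 0" "breakpoint t (Suc n) = 1"
  shows "t \<in> standard_simplex n"
proof -
  have s: "(\<Sum>i\<le>n. t i) = 1"
    using assms(3) by (simp add: breakpoint_def lessThan_Suc_atMost)
  have "t i \<le> 1" for i
  proof (cases "i \<le> n")
    case True
    then have "t i \<le> (\<Sum>i\<le>n. t i)" using assms(1) by (intro member_le_sum) auto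
    then show ?thesis using s by simp
  qed (use assms(2) in auto)
  then show ?thesis using assms s by (auto simp: standard_simplex_def)
qed

lemma step_index_less_iff:
  assumes "t \<in> standard_simplex n" "u \<in> {0..<1}"
  shows "step_index t u < j \<longleftrightarrow> u < breakpoint t j"
proof
  have "u < breakpoint t (Suc n)" using assms breakpoint_top[of t n "Suc n"] by simp
  then have "u < breakpoint t (Suc (step_index t u))"
    unfolding step_index_def by (rule LeastI)
  moreover assume "step_index t u < j"
  ultimately show "u < breakpoint t j"
    using breakpoint_mono[OF assms(1), of "Suc (step_index t u)" j] by simp
next
  assume u: "u < breakpoint t j"
  with assms(2) obtain i where i: "j = Suc i" by (cases j) auto
  with u have "step_index t u \<le> i" unfolding step_index_def by (intro Least_le) simp
  with i show "step_index t u < j" by simp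
qed

lemma step_index_le:
  assumes "t \<in> standard_simplex n" "u \<in> {0..<1}"
  shows "step_index t u \<le> n"
  using step_index_less_iff[OF assms, of "Suc n"] assms breakpoint_top[of t n "Suc n"] by simp

lemma step_index_eq_iff:
  assumes "t \<in> standard_simplex n" "u \<in> {0..<1}"
  shows "step_index t u = j \<longleftrightarrow> breakpoint t j \<le> u \<and> u < breakpoint t (Suc j)"
  using step_index_less_iff[OF assms, of j] step_index_less_iff[OF assms, of "Suc j"] by linarith

lemma step_index_mono:
  assumes "t \<in> standard_simplex n" "u \<in> {0..<1}" "v \<in> {0..<1}" "u \<le> v"
  shows "step_index t u \<le> step_index t v"
  using step_index_less_iff[OF assms(1,2), of "Suc (step_index t v)"]
    step_index_less_iff[OF assms(1,3), of "Suc (step_index t v)"] assms(4) by simp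

lemma breakpoint_push:
  "breakpoint (simplex_push m \<theta> t) j = (\<Sum>i | i \<le> m \<and> \<theta> i < j. t i)"
proof (induction j)
  case (Suc j)
  have "{i. i \<le> m \<and> \<theta> i < Suc j} = {i. i \<le> m \<and> \<theta> i < j} \<union> {i. i \<le> m \<and> \<theta> i = j}" by auto
  then have "(\<Sum>i | i \<le> m \<and> \<theta> i < Suc j. t i)
      = (\<Sum>i | i \<le> m \<and> \<theta> i < j. t i) + (\<Sum>i | i \<le> m \<and> \<theta> i = j. t i)"
    by (simp add: sum.union_disjoint[symmetric] disjoint_iff)
  then show ?case using Suc by (simp add: breakpoint_Suc simplex_push_def)
qed simp

lemma order_maps_le: "\<theta> \<in> order_maps m n \<Longrightarrow> i \<le> m \<Longrightarrow> \<theta> i \<le> n"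
  by (auto simp: order_maps_def)

lemma order_maps_mono: "\<theta> \<in> order_maps m n \<Longrightarrow> i \<le> j \<Longrightarrow> j \<le> m \<Longrightarrow> \<theta> i \<le> \<theta> j"
  by (auto simp: order_maps_def mono_on_def)

lemma simplex_push_in_simplex:
  assumes "\<theta> \<in> order_maps m n" "t \<in> standard_simplex m"
  shows "simplex_push m \<theta> t \<in> standard_simplex n"
proof (rule standard_simplexI)
  show "0 \<le> simplex_push m \<theta> t i" for i
    using assms(2) by (auto simp: simplex_push_def standard_simplex_def intro: sum_nonneg)
  show "simplex_push m \<theta> t i = 0" if "n < i" for i
  proof -
    have "{k. k \<le> m \<and> \<theta> k = i} = {}" using order_maps_le[OF assms(1)] that by fastforce
    then show ?thesis by (simp only: simplex_push_def sum.empty)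
  qed
  have "{i. i \<le> m \<and> \<theta> i < Suc n} = {..m}" using order_maps_le[OF assms(1)] by (auto simp: less_Suc_eq_le)
  then show "breakpoint (simplex_push m \<theta> t) (Suc n) = 1"
    using assms(2) by (simp add: breakpoint_push standard_simplex_def)
qed

text \<open>
  Adding up the coordinates along a monotone map merges neighbouring intervals.  Hence the step
  function attached to a point of the nerve does not change under the gluing relation.
\<close>

lemma step_index_push:
  assumes \<theta>: "\<theta> \<in> order_maps m n" and t: "t \<in> standard_simplex m" and u: "u \<in> {0..<1}"
  shows "step_index (simplex_push m \<theta> t) u = \<theta> (step_index t u)"
proof -
  define j where "j = step_index t u"
  have j: "j \<le> m" "breakpoint t j \<le> u" "u < breakpoint t (Suc j)"
    using step_index_le[OF t u] step_index_eq_iff[OF t u, of j] by (auto simp: j_def)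
  have nn: "0 \<le> t i" for i using t by (simp add: standard_simplex_def)
  have "breakpoint (simplex_push m \<theta> t) (\<theta> j) \<le> breakpoint t j"
    unfolding breakpoint_push unfolding breakpoint_def
    using order_maps_mono[OF \<theta>, of j] nn by (intro sum_mono2) (auto simp: not_less[symmetric])
  moreover have "breakpoint t (Suc j) \<le> breakpoint (simplex_push m \<theta> t) (Suc (\<theta> j))"
    unfolding breakpoint_push unfolding breakpoint_def
    using order_maps_mono[OF \<theta> _ j(1)] nn j(1) by (intro sum_mono2) (auto simp: less_Suc_eq_le)
  ultimately show ?thesis
    using j u step_index_eq_iff[OF simplex_push_in_simplex[OF \<theta> t] u, of "\<theta> j"]
    by (simp add: j_def)
qed

text \<open>
  The refinement is cut at all breakpoints of \<open>t\<close> and \<open>t'\<close>, each taken once, so that none of its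
  intervals is empty.  The last clause records this: every index of the refinement is visible at
  some \<open>u\<close>, and so functions of the indices can be compared through step functions.
\<close>

lemma common_refinement:
  assumes t: "t \<in> standard_simplex n" and t': "t' \<in> standard_simplex m"
  obtains N r \<theta> \<theta>' where "r \<in> standard_simplex N" "\<theta> \<in> order_maps N n" "\<theta>' \<in> order_maps N m"
    "simplex_push N \<theta> r = t" "simplex_push N \<theta>' r = t'"
    "\<And>i. i \<le> N \<Longrightarrow> \<exists>u\<in>{0..<1}. step_index t u = \<theta> i \<and> step_index t' u = \<theta>' i"
proof -
  define P where "P = breakpoint t ` {..Suc n} \<union> breakpoint t' ` {..Suc m}"
  define xs where "xs = sorted_list_of_set P"
  define p where "p i = xs ! i" for i
  have P: "finite P" "P \<subseteq> {0..1}" "0 \<in> P" "1 \<in> P"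
  proof -
    show "finite P" by (simp add: P_def)
    show "P \<subseteq> {0..1}" using breakpoint_bounds[OF t] breakpoint_bounds[OF t'] by (auto simp: P_def)
    show "0 \<in> P" unfolding P_def by (intro UnI1 image_eqI[of _ _ 0]) auto
    show "1 \<in> P" unfolding P_def
      by (intro UnI1 image_eqI[of _ _ "Suc n"]) (use breakpoint_top[OF t, of "Suc n"] in auto)
  qed
  have xs: "set xs = P" "sorted_wrt (<) xs" using P by (auto simp: xs_def)
  have "{0, 1} \<subseteq> set xs" using P xs by auto
  from card_mono[OF List.finite_set this] have "2 \<le> length xs"
    using card_length[of xs] by simp
  then obtain N where N: "length xs = Suc (Suc N)" using le_Suc_ex[of 2] by auto
  have pless: "p i < p j \<longleftrightarrow> i < j" if "i \<le> Suc N" "j \<le> Suc N" for i j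
    using sorted_wrt_nth_less[OF xs(2), of i j] sorted_wrt_nth_less[OF xs(2), of j i] that N
    by (cases i j rule: linorder_cases) (auto simp: p_def)
  have pP: "p i \<in> P" if "i \<le> Suc N" for i using that N xs(1) by (auto simp: p_def intro: nth_mem)
  have pex: "\<exists>k\<le>Suc N. p k = x" if "x \<in> P" for x
    using that xs(1) N by (auto simp: p_def in_set_conv_nth less_Suc_eq_le)
  have p0: "p 0 = 0"
  proof -
    obtain k where "k \<le> Suc N" "p k = 0" using pex P by blast
    moreover have "0 \<le> p 0" using pP[of 0] P by auto
    ultimately show ?thesis using pless[of 0 k] by (cases k) auto
  qed
  have p1: "p (Suc N) = 1"
  proof -
    obtain k where "k \<le> Suc N" "p k = 1" using pex P by blast
    moreover have "p (Suc N) \<le> 1" using pP[of "Suc N"] P by auto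
    ultimately show ?thesis using pless[of k "Suc N"] by (cases "k = Suc N") auto
  qed
  \<comment> \<open>There are \<open>N + 2\<close> breakpoints including \<open>0\<close> and \<open>1\<close>, hence intervals \<open>0, \<dots>, N\<close>.\<close>
  define r where "r i = (if i \<le> N then p (Suc i) - p i else 0)" for i
  have br: "breakpoint r k = p k" if "k \<le> Suc N" for k
    using that by (induction k) (auto simp: breakpoint_Suc r_def p0)
  have r: "r \<in> standard_simplex N"
  proof (rule standard_simplexI)
    show "0 \<le> r i" for i using pless[of i "Suc i"] by (auto simp: r_def)
    show "breakpoint r (Suc N) = 1" using br[of "Suc N"] p1 by simp
  qed (simp add: r_def)
  have pu: "p i \<in> {0..<1}" if "i \<le> N" for i
    using pP[of i] P pless[of i "Suc N"] p1 that by auto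
  have main: "(\<lambda>i. step_index s (p i)) \<in> order_maps N l \<and> simplex_push N (\<lambda>i. step_index s (p i)) r = s"
    if s: "s \<in> standard_simplex l" and sP: "breakpoint s ` {..Suc l} \<subseteq> P" for s l
  proof
    have "p i \<le> p j" if "i \<le> j" "j \<le> N" for i j
      using pless[of j i] that by linarith
    then have "step_index s (p i) \<le> step_index s (p j)" if "i \<le> j" "j \<le> N" for i j
      using that by (intro step_index_mono[OF s pu pu]) auto
    then show "(\<lambda>i. step_index s (p i)) \<in> order_maps N l"
      using step_index_le[OF s pu] by (auto simp: order_maps_def mono_on_def)
    show "simplex_push N (\<lambda>i. step_index s (p i)) r = s"
    proof (rule breakpoint_eqD)
      fix j
      have "breakpoint s j \<in> P"
        using sP breakpoint_top[OF s, of j] P by (cases "j \<le> Suc l") auto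
      then obtain k where k: "k \<le> Suc N" "p k = breakpoint s j" using pex by blast
      have "{i. i \<le> N \<and> step_index s (p i) < j} = {..<k}"
        using step_index_less_iff[OF s pu, of _ j] k pless[of _ k] by auto
      then show "breakpoint (simplex_push N (\<lambda>i. step_index s (p i)) r) j = breakpoint s j"
        using br[OF k(1)] k by (simp add: breakpoint_push breakpoint_def[of r])
    qed
  qed
  have "breakpoint t ` {..Suc n} \<subseteq> P" "breakpoint t' ` {..Suc m} \<subseteq> P" by (auto simp: P_def)
  with main[OF t] main[OF t'] pu show thesis
    by (intro that[OF r, of "\<lambda>i. step_index t (p i)" "\<lambda>i. step_index t' (p i)"]) blast+
qed

section \<open>Points of the classifying space as step functions\<close>

text \<open>
  The image in the nerve of \<open>G\<close> of the simplex with vertices \<open>v 0, \<dots>, v n\<close> in the universal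
  cover \<open>EG\<close>, the realization of the category with object set \<open>G\<close> and exactly one arrow between any
  two objects.
\<close>

definition vertex_simplex :: "'g monoid \<Rightarrow> nat \<Rightarrow> (nat \<Rightarrow> 'g) \<Rightarrow> nat \<times> nat \<Rightarrow> 'g" where
  "vertex_simplex G n v = (\<lambda>(i, j) \<in> arrows n. inv\<^bsub>G\<^esub> (v i) \<otimes>\<^bsub>G\<^esub> v j)"

definition cell_class :: "'g monoid \<Rightarrow> nat \<Rightarrow> (nat \<Rightarrow> 'g) \<Rightarrow> (nat \<Rightarrow> real) \<Rightarrow> 'g cell_point set" where
  "cell_class G n v t = glue_equiv G `` {(n, vertex_simplex G n v, t)}"

definition step_fun :: "(nat \<Rightarrow> 'g) \<Rightarrow> (nat \<Rightarrow> real) \<Rightarrow> real \<Rightarrow> 'g" where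
  "step_fun v t = (\<lambda>u\<in>{0..<1}. v (step_index t u))"

definition step_functions :: "'g monoid \<Rightarrow> (real \<Rightarrow> 'g) set" where
  "step_functions G = {step_fun v t | n v t. v \<in> {..n} \<rightarrow> carrier G \<and> t \<in> standard_simplex n}"

definition translate :: "'g monoid \<Rightarrow> 'g \<Rightarrow> (real \<Rightarrow> 'g) \<Rightarrow> real \<Rightarrow> 'g" where
  "translate G g f = (\<lambda>u\<in>{0..<1}. g \<otimes>\<^bsub>G\<^esub> f u)"

text \<open>
  The projection \<open>EG \<rightarrow> BG\<close>, where the points of \<open>EG\<close> are described by step functions.  It is
  well defined by \<open>cell_class_eq_iff\<close> with \<open>g = \<one>\<close>.
\<close>

definition realize :: "'g monoid \<Rightarrow> (real \<Rightarrow> 'g) \<Rightarrow> 'g cell_point set" where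
  "realize G f = (THE x. \<exists>n v t. v \<in> {..n} \<rightarrow> carrier G \<and> t \<in> standard_simplex n \<and>
      f = step_fun v t \<and> x = cell_class G n v t)"

abbreviation points :: "'g monoid \<Rightarrow> 'g cell_point set set" where
  "points G \<equiv> cell_points G // glue_equiv G"

lemma equiv_glue_equiv: "equiv UNIV (glue_equiv G)"
proof (rule equivI)
  show "sym (glue_equiv G)" unfolding glue_equiv_def
    by (intro sym_rtrancl sym_Un_converse)
qed (auto simp: glue_equiv_def refl_on_def trans_rtrancl)

lemma glue_equiv_class_eq: "(c, c') \<in> glue_equiv G \<Longrightarrow> glue_equiv G `` {c} = glue_equiv G `` {c'}"
  by (rule equiv_class_eq[OF equiv_glue_equiv])

lemma glue_invariant:
  assumes "(c, c') \<in> glue_equiv G" and "\<And>c c'. (c, c') \<in> glue G \<Longrightarrow> F c = F c'"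
  shows "F c = F c'"
  using assms(1) unfolding glue_equiv_def
  by (induction rule: rtrancl_induct) (use assms(2) in auto)

lemma vertex_simplex_cong:
  "(\<And>i. i \<le> n \<Longrightarrow> v i = w i) \<Longrightarrow> vertex_simplex G n v = vertex_simplex G n w"
  unfolding vertex_simplex_def by (rule restrict_ext) (auto simp: arrows_def)

lemma cell_class_cong:
  "(\<And>i. i \<le> n \<Longrightarrow> v i = w i) \<Longrightarrow> cell_class G n v t = cell_class G n w t"
  unfolding cell_class_def using vertex_simplex_cong[of n v w G] by simp

lemma vertex_simplex_pullback:
  assumes "\<theta> \<in> order_maps m n"
  shows "nerve_pullback m \<theta> (vertex_simplex G n v) = vertex_simplex G m (v \<circ> \<theta>)"
  unfolding nerve_pullback_def vertex_simplex_def
  by (rule restrict_ext) (use order_maps_le[OF assms] order_maps_mono[OF assms] in \<open>auto simp: arrows_def\<close>)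

lemma translate_apply: "u \<in> {0..<1} \<Longrightarrow> translate G g f u = g \<otimes>\<^bsub>G\<^esub> f u"
  by (simp add: translate_def)

lemma translate_step_fun: "translate G g (step_fun v t) = step_fun (\<lambda>i. g \<otimes>\<^bsub>G\<^esub> v i) t"
  by (rule ext) (simp add: translate_def step_fun_def)

lemma step_fun_cong:
  assumes "t \<in> standard_simplex n" "\<And>i. i \<le> n \<Longrightarrow> v i = w i"
  shows "step_fun v t = step_fun w t"
  using assms step_index_le[OF assms(1)] by (auto simp: step_fun_def)

lemma step_functionsI:
  "v \<in> {..n} \<rightarrow> carrier G \<Longrightarrow> t \<in> standard_simplex n \<Longrightarrow> step_fun v t \<in> step_functions G"
  by (auto simp: step_functions_def)

lemma step_functionsE:
  assumes "f \<in> step_functions G"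
  obtains n v t where "v \<in> {..n} \<rightarrow> carrier G" "t \<in> standard_simplex n" "f = step_fun v t"
  using assms by (auto simp: step_functions_def)

lemma step_function_carrier: "f \<in> step_functions G \<Longrightarrow> u \<in> {0..<1} \<Longrightarrow> f u \<in> carrier G"
proof (elim step_functionsE)
  fix n v t assume "u \<in> {0..<1}" and v: "v \<in> {..n} \<rightarrow> carrier G" and "t \<in> standard_simplex n" "f = step_fun v t"
  moreover from this have "step_index t u \<in> {..n}" by (auto intro: step_index_le)
  with v have "v (step_index t u) \<in> carrier G" by (rule funcset_mem)
  ultimately show "f u \<in> carrier G" by (simp add: step_fun_def)
qed

lemma step_function_eqI:
  assumes "f \<in> step_functions G" "h \<in> step_functions H" "\<And>u. u \<in> {0..<1} \<Longrightarrow> f u = h u"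
  shows "f = h"
proof
  fix u show "f u = h u"
    using assms by (cases "u \<in> {0..<1}") (auto simp: step_functions_def step_fun_def)
qed

locale discrete_group = group G for G :: "'g monoid" (structure)
begin

lemma nerve_carrier: "\<sigma> \<in> nerve G n \<Longrightarrow> i \<le> j \<Longrightarrow> j \<le> n \<Longrightarrow> \<sigma> (i, j) \<in> carrier G"
  by (auto simp: nerve_def arrows_def PiE_def Pi_def)

lemma nerve_comp:
  "\<sigma> \<in> nerve G n \<Longrightarrow> i \<le> j \<Longrightarrow> j \<le> k \<Longrightarrow> k \<le> n \<Longrightarrow> \<sigma> (i, j) \<otimes> \<sigma> (j, k) = \<sigma> (i, k)"
  by (auto simp: nerve_def)

lemma nerve_eq_vertex_simplex:
  assumes "\<sigma> \<in> nerve G n"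
  shows "\<sigma> = vertex_simplex G n (\<lambda>i. \<sigma> (0, i))"
proof
  fix e :: "nat \<times> nat"
  obtain i j where e: "e = (i, j)" by (cases e)
  show "\<sigma> e = vertex_simplex G n (\<lambda>i. \<sigma> (0, i)) e"
  proof (cases "i \<le> j \<and> j \<le> n")
    case True
    then have "\<sigma> (i, j) = inv (\<sigma> (0, i)) \<otimes> \<sigma> (0, j)"
      using nerve_comp[OF assms, of 0 i j] nerve_carrier[OF assms, of 0 i] nerve_carrier[OF assms, of 0 j]
        nerve_carrier[OF assms, of i j] inv_solve_left by force
    then show ?thesis using True by (simp add: vertex_simplex_def e arrows_def)
  next
    case False
    then show ?thesis using assms by (auto simp: vertex_simplex_def e arrows_def nerve_def)
  qed
qed

lemma vertex_simplex_in_nerve: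
  assumes "v \<in> {..n} \<rightarrow> carrier G"
  shows "vertex_simplex G n v \<in> nerve G n"
proof -
  have c: "v i \<in> carrier G" if "i \<le> n" for i using assms that by auto
  have "inv (v i) \<otimes> v j \<otimes> (inv (v j) \<otimes> v k) = inv (v i) \<otimes> v k" if "i \<le> j" "j \<le> k" "k \<le> n" for i j k
  proof -
    have "v i \<in> carrier G" "v j \<in> carrier G" "v k \<in> carrier G" using that c by auto
    then show ?thesis by (simp add: m_assoc) (simp add: m_assoc[symmetric])
  qed
  with c show ?thesis by (auto simp: nerve_def vertex_simplex_def arrows_def PiE_def Pi_def extensional_def)
qed

lemma cell_class_pull:
  assumes "v \<in> {..n} \<rightarrow> carrier G" "\<theta> \<in> order_maps m n" "t \<in> standard_simplex m"
  shows "cell_class G m (v \<circ> \<theta>) t = cell_class G n v (simplex_push m \<theta> t)"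
  unfolding cell_class_def
proof (rule glue_equiv_class_eq)
  have "((m, vertex_simplex G m (v \<circ> \<theta>), t), (n, vertex_simplex G n v, simplex_push m \<theta> t)) \<in> glue G"
    unfolding glue_def vertex_simplex_pullback[OF assms(2), symmetric]
    using vertex_simplex_in_nerve[OF assms(1)] assms by blast
  then show "((m, vertex_simplex G m (v \<circ> \<theta>), t), (n, vertex_simplex G n v, simplex_push m \<theta> t)) \<in> glue_equiv G"
    by (auto simp: glue_equiv_def)
qed

lemma cell_class_translate:
  assumes "v \<in> {..n} \<rightarrow> carrier G" "g \<in> carrier G"
  shows "cell_class G n (\<lambda>i. g \<otimes> v i) t = cell_class G n v t"
proof -
  have "inv (g \<otimes> v i) \<otimes> (g \<otimes> v j) = inv (v i) \<otimes> v j" if "i \<le> j" "j \<le> n" for i j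
  proof -
    have c: "v i \<in> carrier G" "v j \<in> carrier G" using that assms by auto
    then have "inv (g \<otimes> v i) \<otimes> (g \<otimes> v j) = inv (v i) \<otimes> (inv g \<otimes> (g \<otimes> v j))"
      using assms(2) by (simp add: inv_mult_group m_assoc)
    also have "inv g \<otimes> (g \<otimes> v j) = v j" using c assms(2) by (simp add: m_assoc[symmetric])
    finally show ?thesis .
  qed
  then have "vertex_simplex G n (\<lambda>i. g \<otimes> v i) = vertex_simplex G n v"
    unfolding vertex_simplex_def by (intro restrict_ext) (auto simp: arrows_def)
  then show ?thesis by (simp add: cell_class_def)
qed

lemma cell_class_in_points:
  assumes "v \<in> {..n} \<rightarrow> carrier G" "t \<in> standard_simplex n"
  shows "cell_class G n v t \<in> points G"
  unfolding cell_class_def using vertex_simplex_in_nerve[OF assms(1)] assms(2)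
  by (intro quotientI) (auto simp: cell_points_def)

lemma pointsE:
  assumes "x \<in> points G"
  obtains n v t where "v \<in> {..n} \<rightarrow> carrier G" "t \<in> standard_simplex n" "x = cell_class G n v t"
proof -
  from assms obtain n \<sigma> t where "\<sigma> \<in> nerve G n" "t \<in> standard_simplex n" "x = glue_equiv G `` {(n, \<sigma>, t)}"
    by (auto simp: quotient_def cell_points_def)
  then show thesis
    using nerve_eq_vertex_simplex[of \<sigma> n] nerve_carrier[of \<sigma> n 0]
    by (intro that[of "\<lambda>i. \<sigma> (0, i)" n t]) (auto simp: cell_class_def)
qed

text \<open>
  The points of \<open>BG\<close> are the step functions up to left translation.  A step function determines its
  point because two descriptions of it can be pulled back to a common refinement, where they have
  the same vertices.  Conversely, the set of all translates of the step function of a cell point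
  is not changed by the gluing relation.
\<close>

lemma cell_class_eq_iff:
  assumes v: "v \<in> {..n} \<rightarrow> carrier G" and t: "t \<in> standard_simplex n"
    and w: "w \<in> {..m} \<rightarrow> carrier G" and t': "t' \<in> standard_simplex m"
  shows "cell_class G n v t = cell_class G m w t' \<longleftrightarrow>
    (\<exists>g\<in>carrier G. step_fun w t' = translate G g (step_fun v t))" (is "?L \<longleftrightarrow> ?R")
proof
  assume ?R
  then obtain g where g: "g \<in> carrier G" and eq: "step_fun w t' = translate G g (step_fun v t)" by blast
  obtain N r \<theta> \<theta>' where r: "r \<in> standard_simplex N" "\<theta> \<in> order_maps N n" "\<theta>' \<in> order_maps N m"
    "simplex_push N \<theta> r = t" "simplex_push N \<theta>' r = t'"
    "\<And>i. i \<le> N \<Longrightarrow> \<exists>u\<in>{0..<1}. step_index t u = \<theta> i \<and> step_index t' u = \<theta>' i"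
    using common_refinement[OF t t'] by metis
  have "(w \<circ> \<theta>') i = ((\<lambda>i. g \<otimes> v i) \<circ> \<theta>) i" if i: "i \<le> N" for i
  proof -
    obtain u where u: "u \<in> {0..<1}" "step_index t u = \<theta> i" "step_index t' u = \<theta>' i"
      using r(6)[OF i] by blast
    from fun_cong[OF eq, of u] show ?thesis
      using u by (simp add: step_fun_def translate_def)
  qed
  then have "cell_class G N (w \<circ> \<theta>') r = cell_class G N ((\<lambda>i. g \<otimes> v i) \<circ> \<theta>) r"
    by (rule cell_class_cong)
  moreover have "(\<lambda>i. g \<otimes> v i) \<in> {..n} \<rightarrow> carrier G" using v g by auto
  ultimately show ?L
    using cell_class_pull[OF w r(3) r(1)] cell_class_pull[OF _ r(2) r(1)] r cell_class_translate[OF v g]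
    by simp
next
  assume ?L
  \<comment> \<open>The step functions of all lifts of the point of a cell; they are constant along the gluing relation.\<close>
  define L where "L c = (case c of (n::nat, \<sigma>, t) \<Rightarrow> {\<lambda>u\<in>{0..<1::real}. g \<otimes> \<sigma> (0::nat, step_index t u) | g. g \<in> carrier G})"
    for c :: "'g cell_point"
  have L: "L (n, vertex_simplex G n v, t) = {translate G g (step_fun v t) | g. g \<in> carrier G}"
    if v: "v \<in> {..n} \<rightarrow> carrier G" and t: "t \<in> standard_simplex n" for n v t
  proof -
    have v0: "v 0 \<in> carrier G" using v by auto
    have *: "(\<lambda>u\<in>{0..<1}. g \<otimes> vertex_simplex G n v (0, step_index t u)) = translate G (g \<otimes> inv (v 0)) (step_fun v t)"
      if "g \<in> carrier G" for g
      unfolding translate_def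
    proof (rule restrict_ext)
      fix u :: real assume u: "u \<in> {0..<1}"
      have "step_index t u \<le> n" using step_index_le[OF t u] .
      moreover from this have "v (step_index t u) \<in> carrier G" using v by auto
      ultimately show "g \<otimes> vertex_simplex G n v (0, step_index t u) = g \<otimes> inv (v 0) \<otimes> step_fun v t u"
        using u v0 that by (simp add: vertex_simplex_def arrows_def step_fun_def m_assoc)
    qed
    have **: "translate G g (step_fun v t) = (\<lambda>u\<in>{0..<1}. (g \<otimes> v 0) \<otimes> vertex_simplex G n v (0, step_index t u))"
      if "g \<in> carrier G" for g
      using *[of "g \<otimes> v 0"] that v0 by (simp add: m_assoc)
    show ?thesis unfolding L_def prod.case
    proof (intro equalityI subsetI)
      fix f assume "f \<in> {\<lambda>u\<in>{0..<1}. g \<otimes> vertex_simplex G n v (0, step_index t u) |g. g \<in> carrier G}"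
      then obtain g where "g \<in> carrier G" "f = translate G (g \<otimes> inv (v 0)) (step_fun v t)" using * by auto
      then show "f \<in> {translate G g (step_fun v t) |g. g \<in> carrier G}" using v0 by blast
    next
      fix f assume "f \<in> {translate G g (step_fun v t) |g. g \<in> carrier G}"
      then obtain g where "g \<in> carrier G" "f = translate G g (step_fun v t)" by auto
      then show "f \<in> {\<lambda>u\<in>{0..<1}. g \<otimes> vertex_simplex G n v (0, step_index t u) |g. g \<in> carrier G}"
        using **[of g] v0 by blast
    qed
  qed
  have "L c = L c'" if "(c, c') \<in> glue G" for c c'
  proof -
    from that obtain m n \<theta> \<sigma> t where c: "c = (m, nerve_pullback m \<theta> \<sigma>, t)" "c' = (n, \<sigma>, simplex_push m \<theta> t)"
      and \<theta>: "\<theta> \<in> order_maps m n" and s: "\<sigma> \<in> nerve G n" and t: "t \<in> standard_simplex m"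
      by (auto simp: glue_def)
    define v where "v i = \<sigma> (0, i)" for i
    have \<sigma>: "\<sigma> = vertex_simplex G n v" unfolding v_def by (rule nerve_eq_vertex_simplex[OF s])
    have v: "v \<in> {..n} \<rightarrow> carrier G" using nerve_carrier[OF s] by (auto simp: v_def)
    then have v': "v \<circ> \<theta> \<in> {..m} \<rightarrow> carrier G" using order_maps_le[OF \<theta>] by auto
    have "step_fun (v \<circ> \<theta>) t = step_fun v (simplex_push m \<theta> t)"
      unfolding step_fun_def by (rule restrict_ext) (simp add: step_index_push[OF \<theta> t])
    then show ?thesis
      unfolding c \<sigma> vertex_simplex_pullback[OF \<theta>]
      using L[OF v' t] L[OF v simplex_push_in_simplex[OF \<theta> t]] by simp
  qed
  note inv = glue_invariant[of _ _ _ L, OF _ this]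
  have "((n, vertex_simplex G n v, t), (m, vertex_simplex G m w, t')) \<in> glue_equiv G"
    using \<open>?L\<close> eq_equiv_class[OF _ equiv_glue_equiv] unfolding cell_class_def by (metis UNIV_I)
  from inv[OF this] have "{translate G g (step_fun v t) | g. g \<in> carrier G} = {translate G g (step_fun w t') | g. g \<in> carrier G}"
    using L[OF v t] L[OF w t'] by simp
  moreover have "step_fun w t' \<in> {translate G g (step_fun w t') | g. g \<in> carrier G}"
  proof -
    have "translate G \<one> (step_fun w t') = step_fun w t'"
      unfolding translate_step_fun
    proof (rule step_fun_cong[OF t'])
      fix i assume "i \<le> m"
      then have "w i \<in> carrier G" using w by auto
      then show "\<one> \<otimes> w i = w i" by simp
    qed
    then show ?thesis by (metis (mono_tags, lifting) mem_Collect_eq one_closed)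
  qed
  ultimately show ?R by auto
qed

lemma translate_in_step_functions:
  assumes "f \<in> step_functions G" "g \<in> carrier G"
  shows "translate G g f \<in> step_functions G"
  using assms(1)
proof (rule step_functionsE)
  fix n v t assume f: "v \<in> {..n} \<rightarrow> carrier G" "t \<in> standard_simplex n" "f = step_fun v t"
  then have "(\<lambda>i. g \<otimes> v i) \<in> {..n} \<rightarrow> carrier G" using assms(2) by auto
  then show ?thesis using f by (simp add: translate_step_fun step_functionsI)
qed

lemma translate_one: "f \<in> step_functions G \<Longrightarrow> translate G \<one> f = f"
  by (rule step_function_eqI[of _ G _ G])
    (auto simp: translate_apply step_function_carrier dest: translate_in_step_functions[OF _ one_closed])

lemma realize_step_fun:
  assumes v: "v \<in> {..n} \<rightarrow> carrier G" and t: "t \<in> standard_simplex n"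
  shows "realize G (step_fun v t) = cell_class G n v t"
  unfolding realize_def
proof (rule the_equality)
  fix x assume "\<exists>m w t'. w \<in> {..m} \<rightarrow> carrier G \<and> t' \<in> standard_simplex m \<and>
      step_fun v t = step_fun w t' \<and> x = cell_class G m w t'"
  then obtain m w t' where w: "w \<in> {..m} \<rightarrow> carrier G" "t' \<in> standard_simplex m"
      "step_fun v t = step_fun w t'" "x = cell_class G m w t'" by blast
  have "step_fun w t' = translate G \<one> (step_fun v t)"
    using w(3) translate_one[OF step_functionsI[OF v t]] by simp
  then have "cell_class G n v t = cell_class G m w t'"
    unfolding cell_class_eq_iff[OF v t w(1,2)] by (intro bexI[of _ \<one>]) auto
  then show "x = cell_class G n v t" using w(4) by simp
qed (use v t in blast)

lemma realize_in_points: "f \<in> step_functions G \<Longrightarrow> realize G f \<in> points G"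
  by (elim step_functionsE) (auto simp: realize_step_fun cell_class_in_points)

lemma realize_onto:
  assumes "x \<in> points G" obtains f where "f \<in> step_functions G" "x = realize G f"
proof -
  obtain n v t where "v \<in> {..n} \<rightarrow> carrier G" "t \<in> standard_simplex n" "x = cell_class G n v t"
    using assms by (rule pointsE)
  then show thesis using that[of "step_fun v t"] by (simp add: realize_step_fun step_functionsI)
qed

lemma realize_eq_iff:
  assumes "f \<in> step_functions G" "h \<in> step_functions G"
  shows "realize G f = realize G h \<longleftrightarrow> (\<exists>g\<in>carrier G. h = translate G g f)"
  using assms by (elim step_functionsE) (simp add: realize_step_fun cell_class_eq_iff)

lemma realize_translate:
  "f \<in> step_functions G \<Longrightarrow> g \<in> carrier G \<Longrightarrow> realize G (translate G g f) = realize G f"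
  using realize_eq_iff[of f "translate G g f"] translate_in_step_functions by blast

lemma translate_translate:
  assumes "f \<in> step_functions G" "g \<in> carrier G" "h \<in> carrier G"
  shows "translate G g (translate G h f) = translate G (g \<otimes> h) f"
  unfolding translate_def using step_function_carrier[OF assms(1)] assms(2,3)
  by (intro restrict_ext) (simp add: m_assoc)

end

definition map_step :: "('g \<Rightarrow> 'h) \<Rightarrow> (real \<Rightarrow> 'g) \<Rightarrow> real \<Rightarrow> 'h" where
  "map_step \<phi> f = (\<lambda>u\<in>{0..<1}. \<phi> (f u))"

lemma map_step_step_fun: "map_step \<phi> (step_fun v t) = step_fun (\<phi> \<circ> v) t"
  by (rule ext) (simp add: map_step_def step_fun_def)

lemma map_step_in_step_functions:
  assumes "\<phi> \<in> carrier G \<rightarrow> carrier G'" "f \<in> step_functions G"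
  shows "map_step \<phi> f \<in> step_functions G'"
  using assms(2)
proof (rule step_functionsE)
  fix n v t assume f: "v \<in> {..n} \<rightarrow> carrier G" "t \<in> standard_simplex n" "f = step_fun v t"
  have "\<phi> \<circ> v \<in> {..n} \<rightarrow> carrier G'" using assms(1) f(1) by auto
  then show ?thesis using f by (simp add: map_step_step_fun step_functionsI)
qed

lemma map_step_translate:
  assumes "\<phi> \<in> hom G G'" "f \<in> step_functions G" "g \<in> carrier G"
  shows "map_step \<phi> (translate G g f) = translate G' (\<phi> g) (map_step \<phi> f)"
  unfolding map_step_def translate_def
  using assms step_function_carrier[OF assms(2)] by (intro restrict_ext) (simp add: hom_mult)

text \<open>
  Applying \<open>\<phi>\<close> to the nerve respects the gluing relation, so the image of a point may be computed
  from any one of its representatives.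
\<close>

lemma classifying_map_realize:
  fixes G :: "'g monoid" and G' :: "'h monoid"
  assumes G: "group G" and G': "group G'" and \<phi>: "\<phi> \<in> hom G G'" and f: "f \<in> step_functions G"
  shows "classifying_map G' \<phi> (realize G f) = realize G' (map_step \<phi> f)"
proof -
  interpret group_hom G G' \<phi> by (intro group_hom.intro G G' group_hom_axioms.intro \<phi>)
  interpret G: discrete_group G by (intro discrete_group.intro G)
  interpret H: discrete_group G' by (intro discrete_group.intro G')
  define F where "F c = (case c of (n::nat, \<sigma>, t) \<Rightarrow> (n, (\<lambda>e \<in> arrows n. \<phi> (\<sigma> e)), t))"
    for c :: "'g cell_point"
  obtain n v t where v: "v \<in> {..n} \<rightarrow> carrier G" and t: "t \<in> standard_simplex n" and feq: "f = step_fun v t"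
    using f by (rule step_functionsE)
  have "glue_equiv G' `` {F c} = glue_equiv G' `` {F c'}" if "(c, c') \<in> glue G" for c c'
  proof -
    from that obtain m n \<theta> \<sigma> t where c: "c = (m, nerve_pullback m \<theta> \<sigma>, t)" "c' = (n, \<sigma>, simplex_push m \<theta> t)"
      and \<theta>: "\<theta> \<in> order_maps m n" and s: "\<sigma> \<in> nerve G n" and t: "t \<in> standard_simplex m"
      by (auto simp: glue_def)
    have "(\<lambda>e \<in> arrows m. \<phi> (nerve_pullback m \<theta> \<sigma> e)) = nerve_pullback m \<theta> (\<lambda>e \<in> arrows n. \<phi> (\<sigma> e))"
      unfolding nerve_pullback_def
      by (rule restrict_ext)
        (use order_maps_le[OF \<theta>] order_maps_mono[OF \<theta>] in \<open>auto simp: arrows_def\<close>)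
    moreover have "(\<lambda>e \<in> arrows n. \<phi> (\<sigma> e)) \<in> nerve G' n"
      using s by (auto simp: nerve_def arrows_def PiE_def Pi_def hom_mult[symmetric])
    ultimately have "(F c, F c') \<in> glue G'"
      unfolding c F_def glue_def using \<theta> t by auto
    then show ?thesis by (intro glue_equiv_class_eq) (auto simp: glue_equiv_def)
  qed
  note inv = glue_invariant[of _ _ _ "\<lambda>c. glue_equiv G' `` {F c}", OF _ this]
  define c where "c = (n, vertex_simplex G n v, t)"
  have "F c = (n, vertex_simplex G' n (\<phi> \<circ> v), t)"
    using v unfolding F_def c_def vertex_simplex_def
    by (auto simp: arrows_def fun_eq_iff Pi_def)
  then have 1: "realize G' (map_step \<phi> f) = glue_equiv G' `` {F c}"
    using v t H.realize_step_fun[of "\<phi> \<circ> v" n t] by (simp add: feq map_step_step_fun cell_class_def Pi_def)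
  have "realize G f = glue_equiv G `` {c}"
    using v t by (simp add: feq G.realize_step_fun c_def cell_class_def)
  then have "classifying_map G' \<phi> (realize G f) = glue_equiv G' `` (F ` (glue_equiv G `` {c}))"
    unfolding classifying_map_def F_def by simp
  also have "\<dots> = (\<Union>c'\<in>glue_equiv G `` {c}. glue_equiv G' `` {F c'})"
    by blast
  also have "\<dots> = glue_equiv G' `` {F c}"
  proof -
    have "c \<in> glue_equiv G `` {c}" by (simp add: glue_equiv_def)
    moreover have "glue_equiv G' `` {F c'} = glue_equiv G' `` {F c}" if "c' \<in> glue_equiv G `` {c}" for c'
      using inv[of c c'] that by simp
    ultimately show ?thesis by blast
  qed
  finally show ?thesis using 1 by simp
qed

section \<open>The distance of step functions and the weak topology\<close>

text \<open>
  A metric on step functions for which translations are isometries and each step function has distance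
  \<open>1\<close> from its proper translates.
\<close>

definition step_dist :: "(real \<Rightarrow> 'g) \<Rightarrow> (real \<Rightarrow> 'g) \<Rightarrow> real" where
  "step_dist f h = measure lborel {u \<in> {0..<1}. f u \<noteq> h u}"

abbreviation simplex_space :: "nat \<Rightarrow> (nat \<Rightarrow> real) topology" where
  "simplex_space n \<equiv> subtopology (powertop_real UNIV) (standard_simplex n)"

lemma fmeasurable_subset_unit:
  assumes "A \<in> sets lborel" "A \<subseteq> {0..<1::real}"
  shows "A \<in> fmeasurable lborel"
proof (rule fmeasurableI2[OF _ assms(2,1)])
  show "{0..<1::real} \<in> fmeasurable lborel" by (rule fmeasurableI) simp_all
qed

lemma step_index_diff_measurable:
  assumes t: "t \<in> standard_simplex n" and t': "t' \<in> standard_simplex m"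
  shows "{u \<in> {0..<1}. step_fun v t u \<noteq> step_fun w t' u} \<in> fmeasurable lborel"
proof (rule fmeasurable_subset_unit)
  have level: "{u \<in> {0..<1}. step_index s u = j} \<in> sets lborel"
    if "s \<in> standard_simplex k" for s k j
  proof -
    have "u \<in> {u \<in> {0..<1}. step_index s u = j} \<longleftrightarrow> u \<in> {0..<1} \<inter> {breakpoint s j..<breakpoint s (Suc j)}" for u
      using step_index_eq_iff[OF that, of u j] by auto
    then have "{u \<in> {0..<1}. step_index s u = j} = {0..<1} \<inter> {breakpoint s j..<breakpoint s (Suc j)}"
      by blast
    then show ?thesis by simp
  qed
  have "{u \<in> {0..<1}. step_fun v t u \<noteq> step_fun w t' u} = (\<Union>i. \<Union>j\<in>{j. v i \<noteq> w j}.
      {u \<in> {0..<1}. step_index t u = i} \<inter> {u \<in> {0..<1}. step_index t' u = j})"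
    by (auto simp: step_fun_def)
  also have "\<dots> \<in> sets lborel"
    by (intro sets.countable_UN'' sets.Int level[OF t] level[OF t']) auto
  finally show "{u \<in> {0..<1}. step_fun v t u \<noteq> step_fun w t' u} \<in> sets lborel" .
qed auto

lemma step_diff_measurable:
  assumes "f \<in> step_functions G" "h \<in> step_functions G"
  shows "{u \<in> {0..<1}. f u \<noteq> h u} \<in> fmeasurable lborel"
proof -
  obtain n v t where f: "t \<in> standard_simplex n" "f = step_fun v t" using assms(1) by (rule step_functionsE)
  obtain m w t' where h: "t' \<in> standard_simplex m" "h = step_fun w t'" using assms(2) by (rule step_functionsE)
  show ?thesis unfolding f(2) h(2) by (rule step_index_diff_measurable[OF f(1) h(1)])
qed

lemma step_dist_refl [simp]: "step_dist f f = 0"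
  by (simp add: step_dist_def)

lemma step_dist_sym: "step_dist f h = step_dist h f"
  by (simp add: step_dist_def eq_commute)

lemma step_dist_mono:
  assumes "f \<in> step_functions G" "h \<in> step_functions G" "f' \<in> step_functions G'" "h' \<in> step_functions G'"
    and "\<And>u. u \<in> {0..<1} \<Longrightarrow> f' u = h' u \<Longrightarrow> f u = h u"
  shows "step_dist f h \<le> step_dist f' h'"
  unfolding step_dist_def using assms step_diff_measurable[of f G h] step_diff_measurable[of f' G' h']
  by (intro measure_mono_fmeasurable) auto

lemma step_dist_triangle:
  assumes "f \<in> step_functions G" "h \<in> step_functions G" "k \<in> step_functions G"
  shows "step_dist f k \<le> step_dist f h + step_dist h k"
proof -
  have m: "{u \<in> {0..<1}. f u \<noteq> h u} \<in> fmeasurable lborel" "{u \<in> {0..<1}. h u \<noteq> k u} \<in> fmeasurable lborel"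
    "{u \<in> {0..<1}. f u \<noteq> k u} \<in> fmeasurable lborel"
    using assms by (blast intro: step_diff_measurable)+
  have "step_dist f k \<le> measure lborel ({u \<in> {0..<1}. f u \<noteq> h u} \<union> {u \<in> {0..<1}. h u \<noteq> k u})"
    unfolding step_dist_def using m by (intro measure_mono_fmeasurable) auto
  also have "\<dots> \<le> step_dist f h + step_dist h k"
    unfolding step_dist_def using m by (intro measure_Un_le) auto
  finally show ?thesis .
qed

lemma step_dist_map_step:
  fixes G :: "'g monoid" and G' :: "'h monoid"
  assumes "\<phi> \<in> carrier G \<rightarrow> carrier G'" "f \<in> step_functions G" "h \<in> step_functions G"
  shows "step_dist (map_step \<phi> f) (map_step \<phi> h) \<le> step_dist f h"
  by (rule step_dist_mono[OF map_step_in_step_functions[OF assms(1,2)] map_step_in_step_functions[OF assms(1,3)] assms(2,3)])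
    (simp add: map_step_def)

text \<open>
  Moving a breakpoint changes the step function only between its old and its new position.
\<close>

lemma step_dist_simplex:
  assumes t: "t \<in> standard_simplex n" and t': "t' \<in> standard_simplex n"
  shows "step_dist (step_fun v t) (step_fun v t') \<le> (\<Sum>j\<le>n. \<bar>breakpoint t (Suc j) - breakpoint t' (Suc j)\<bar>)"
proof -
  define I where "I j = {min (breakpoint t (Suc j)) (breakpoint t' (Suc j))..<max (breakpoint t (Suc j)) (breakpoint t' (Suc j))}" for j
  have meas: "measure lborel (I j) = \<bar>breakpoint t (Suc j) - breakpoint t' (Suc j)\<bar>" for j
    unfolding I_def by (simp add: measure_lborel_Ico)
  have sub: "{u \<in> {0..<1}. step_fun v t u \<noteq> step_fun v t' u} \<subseteq> (\<Union>j\<in>{..n}. I j)"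
  proof
    fix u assume u: "u \<in> {u \<in> {0..<1}. step_fun v t u \<noteq> step_fun v t' u}"
    then have u01: "u \<in> {0..<1}" and ne: "step_index t u \<noteq> step_index t' u"
      by (auto simp: step_fun_def)
    define j where "j = min (step_index t u) (step_index t' u)"
    have "j \<le> n" using step_index_le[OF t u01] by (simp add: j_def)
    moreover have "u \<in> I j"
      using step_index_less_iff[OF t u01, of "Suc j"] step_index_less_iff[OF t' u01, of "Suc j"] ne
      by (auto simp: I_def j_def min_def max_def split: if_splits)
    ultimately show "u \<in> (\<Union>j\<in>{..n}. I j)" by blast
  qed
  have fin: "I j \<in> fmeasurable lborel" for j unfolding I_def by (rule fmeasurableI) simp_all
  have "step_dist (step_fun v t) (step_fun v t') \<le> measure lborel (\<Union>j\<in>{..n}. I j)"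
    unfolding step_dist_def using sub step_index_diff_measurable[OF t t', of v v, THEN fmeasurableD]
    by (rule measure_mono_fmeasurable) (intro fmeasurable.finite_UN finite_atMost fin)
  also have "\<dots> \<le> (\<Sum>j\<le>n. measure lborel (I j))"
    by (intro measure_UNION_le finite_atMost) (simp add: I_def)
  finally show ?thesis by (simp add: meas)
qed

lemma continuous_map_breakpoint:
  "continuous_map (simplex_space n) euclideanreal (\<lambda>t. breakpoint t j)"
  unfolding breakpoint_def
  by (intro continuous_map_sum continuous_map_from_subtopology continuous_map_product_projection) auto

context discrete_group
begin

lemma step_dist_translate:
  assumes "f \<in> step_functions G" "h \<in> step_functions G" "g \<in> carrier G"
  shows "step_dist (translate G g f) (translate G g h) = step_dist f h"
proof -
  have "{u \<in> {0..<1}. translate G g f u \<noteq> translate G g h u} = {u \<in> {0..<1}. f u \<noteq> h u}"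
    using assms(3) step_function_carrier[OF assms(1)] step_function_carrier[OF assms(2)]
    by (auto simp: translate_apply)
  then show ?thesis by (simp add: step_dist_def)
qed

lemma translate_far:
  assumes "f \<in> step_functions G" "g \<in> carrier G" "g \<noteq> \<one>"
  shows "step_dist (translate G g f) f = 1"
proof -
  have "{u \<in> {0..<1}. translate G g f u \<noteq> f u} = {0..<1}"
    using assms(2,3) step_function_carrier[OF assms(1)]
    by (auto simp: translate_apply r_cancel_one)
  then show ?thesis by (simp add: step_dist_def)
qed

text \<open>
  This makes \<open>EG \<rightarrow> BG\<close> behave like a covering: near a given lift there is at most one lift of each
  point.
\<close>

lemma near_lift_unique:
  assumes "f \<in> step_functions G" "h \<in> step_functions G" "realize G f = realize G h" "step_dist f h < 1"
  shows "f = h"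
proof -
  obtain g where g: "g \<in> carrier G" "f = translate G g h" using realize_eq_iff[OF assms(2,1)] assms(3) by auto
  then show ?thesis using translate_far[OF assms(2) g(1)] translate_one[OF assms(2)] assms(4) by force
qed

lemma translate_inject:
  assumes "f \<in> step_functions G" "g \<in> carrier G" "h \<in> carrier G" "step_dist (translate G g f) (translate G h f) < 1"
  shows "g = h"
proof -
  have "translate G g f = translate G h f"
    using assms by (intro near_lift_unique) (auto simp: translate_in_step_functions realize_translate)
  from fun_cong[OF this, of 0] show ?thesis
    using assms(2,3) step_function_carrier[OF assms(1), of 0] by (simp add: translate_apply)
qed

text \<open>
  Every simplex of the nerve is the image of a simplex of \<open>EG\<close>, so openness may be tested on the latter.
\<close>

lemma openin_classifying_space:
  "openin (classifying_space G) U \<longleftrightarrow> U \<subseteq> points G \<and>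
    (\<forall>n v. v \<in> {..n} \<rightarrow> carrier G \<longrightarrow>
       openin (simplex_space n) {t \<in> standard_simplex n. realize G (step_fun v t) \<in> U})"
proof -
  have 1: "{t \<in> standard_simplex n. realize G (step_fun v t) \<in> U}
     = {t \<in> standard_simplex n. glue_equiv G `` {(n, vertex_simplex G n v, t)} \<in> U}"
    if "v \<in> {..n} \<rightarrow> carrier G" for n v
    using that by (auto simp: realize_step_fun cell_class_def)
  have 2: "(\<forall>\<sigma>\<in>nerve G n. P \<sigma>) \<longleftrightarrow> (\<forall>v. v \<in> {..n} \<rightarrow> carrier G \<longrightarrow> P (vertex_simplex G n v))" for n P
  proof (intro iffI ballI allI impI)
    fix \<sigma> assume *: "\<forall>v. v \<in> {..n} \<rightarrow> carrier G \<longrightarrow> P (vertex_simplex G n v)" and s: "\<sigma> \<in> nerve G n"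
    have "(\<lambda>i. \<sigma> (0, i)) \<in> {..n} \<rightarrow> carrier G" using nerve_carrier[OF s] by auto
    with * have "P (vertex_simplex G n (\<lambda>i. \<sigma> (0, i)))" by blast
    then show "P \<sigma>" using nerve_eq_vertex_simplex[OF s] by simp
  qed (use vertex_simplex_in_nerve in blast)
  show ?thesis
    unfolding classifying_space_def topology_inverse'[OF istopology_classifying_space]
    unfolding 2 using 1 by simp
qed

lemma topspace_classifying_space [simp]: "topspace (classifying_space G) = points G"
proof
  have "openin (classifying_space G) (points G)"
    unfolding openin_classifying_space
  proof (intro conjI allI impI)
    fix n :: nat and v assume "v \<in> {..n} \<rightarrow> carrier G"
    then have "{t \<in> standard_simplex n. realize G (step_fun v t) \<in> points G} = topspace (simplex_space n)"
      using realize_in_points step_functionsI[of v n G] by auto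
    then show "openin (simplex_space n) {t \<in> standard_simplex n. realize G (step_fun v t) \<in> points G}"
      by (metis openin_topspace)
  qed simp
  then show "points G \<subseteq> topspace (classifying_space G)" by (rule openin_subset)
  show "topspace (classifying_space G) \<subseteq> points G"
    using openin_classifying_space openin_topspace by blast
qed

lemma continuous_map_characteristic:
  assumes "v \<in> {..n} \<rightarrow> carrier G"
  shows "continuous_map (simplex_space n) (classifying_space G) (\<lambda>t. realize G (step_fun v t))"
  unfolding continuous_map_def using assms openin_classifying_space realize_in_points step_functionsI[of v n G]
  by auto

text \<open>
  The weak topology is finer than the topology of \<open>step_dist\<close>.  Hence paths in \<open>BG\<close> are
  continuous for \<open>step_dist\<close>, and path lifting can work with distances.
\<close>

lemma openin_near:
  assumes f0: "f0 \<in> step_functions G"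
  shows "openin (classifying_space G) {realize G f | f. f \<in> step_functions G \<and> step_dist f f0 < \<epsilon>}"
    (is "openin _ ?N")
  unfolding openin_classifying_space
proof (intro conjI allI impI)
  show "?N \<subseteq> points G" using realize_in_points by auto
  fix n :: nat and v assume v: "v \<in> {..n} \<rightarrow> carrier G"
  let ?W = "{t \<in> standard_simplex n. realize G (step_fun v t) \<in> ?N}"
  show "openin (simplex_space n) ?W"
  proof (subst openin_subopen, intro ballI)
    fix t assume "t \<in> ?W"
    then obtain f where t: "t \<in> standard_simplex n" and f: "realize G (step_fun v t) = realize G f"
       "f \<in> step_functions G" "step_dist f f0 < \<epsilon>" by auto
    obtain g where g: "g \<in> carrier G" "f = translate G g (step_fun v t)"
      using realize_eq_iff[OF step_functionsI[OF v t] f(2)] f(1) by auto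
    define F where "F t' = (\<Sum>j\<le>n. \<bar>breakpoint t' (Suc j) - breakpoint t (Suc j)\<bar>)" for t'
    have "continuous_map (simplex_space n) euclideanreal F"
      unfolding F_def
      by (intro continuous_map_sum continuous_map_real_abs continuous_map_diff continuous_map_breakpoint) auto
    then have "openin (simplex_space n) {t' \<in> topspace (simplex_space n). F t' \<in> {..<\<epsilon> - step_dist f f0}}"
      by (rule openin_continuous_map_preimage) auto
    moreover have "t \<in> {t' \<in> topspace (simplex_space n). F t' \<in> {..<\<epsilon> - step_dist f f0}}"
      using t f(3) by (simp add: F_def)
    moreover have "{t' \<in> topspace (simplex_space n). F t' \<in> {..<\<epsilon> - step_dist f f0}} \<subseteq> ?W"
    proof
      fix t' assume "t' \<in> {t' \<in> topspace (simplex_space n). F t' \<in> {..<\<epsilon> - step_dist f f0}}"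
      then have t': "t' \<in> standard_simplex n" and F: "F t' < \<epsilon> - step_dist f f0" by auto
      define f' where "f' = translate G g (step_fun v t')"
      have s: "step_fun v t \<in> step_functions G" "step_fun v t' \<in> step_functions G"
        using v t t' by (auto intro: step_functionsI)
      have f': "f' \<in> step_functions G" "realize G (step_fun v t') = realize G f'"
        using s g by (auto simp: f'_def translate_in_step_functions realize_translate)
      have "step_dist f' f0 \<le> step_dist f' f + step_dist f f0"
        by (rule step_dist_triangle[OF f'(1) f(2) f0])
      also have "step_dist f' f \<le> F t'"
        using step_dist_simplex[OF t' t, of v] by (simp add: f'_def g(2) step_dist_translate[OF s(2,1) g(1)] F_def)
      finally have "step_dist f' f0 < \<epsilon>" using F by simp
      then show "t' \<in> ?W" using t' f' by auto
    qed
    ultimately show "\<exists>T. openin (simplex_space n) T \<and> t \<in> T \<and> T \<subseteq> ?W" by blast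
  qed
qed

end

lemma continuous_map_classifying_map:
  fixes G :: "'g monoid" and G' :: "'h monoid"
  assumes G: "group G" and G': "group G'" and \<phi>: "\<phi> \<in> hom G G'"
  shows "continuous_map (classifying_space G) (classifying_space G') (classifying_map G' \<phi>)"
proof -
  interpret G: discrete_group G by (intro discrete_group.intro G)
  interpret H: discrete_group G' by (intro discrete_group.intro G')
  have c: "\<phi> \<in> carrier G \<rightarrow> carrier G'" using \<phi> by (rule hom_in_carrier[THEN funcsetI])
  have img: "classifying_map G' \<phi> x \<in> points G'" if x: "x \<in> points G" for x
  proof -
    obtain f where f: "f \<in> step_functions G" "x = realize G f" using G.realize_onto[OF x] .
    then show ?thesis
      using classifying_map_realize[OF G G' \<phi> f(1)] H.realize_in_points[OF map_step_in_step_functions[OF c f(1)]]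
      by simp
  qed
  have "openin (classifying_space G) {x \<in> points G. classifying_map G' \<phi> x \<in> U}"
    if U: "openin (classifying_space G') U" for U
    unfolding G.openin_classifying_space
  proof (intro conjI allI impI)
    fix n :: nat and v assume v: "v \<in> {..n} \<rightarrow> carrier G"
    then have v': "\<phi> \<circ> v \<in> {..n} \<rightarrow> carrier G'" using c by auto
    have "step_fun v t \<in> step_functions G" if "t \<in> standard_simplex n" for t
      using v that by (rule step_functionsI)
    then have "{t \<in> standard_simplex n. realize G (step_fun v t) \<in> {x \<in> points G. classifying_map G' \<phi> x \<in> U}}
        = {t \<in> standard_simplex n. realize G' (step_fun (\<phi> \<circ> v) t) \<in> U}"
      using G.realize_in_points by (auto simp: classifying_map_realize[OF G G' \<phi>] map_step_step_fun)
    then show "openin (simplex_space n)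
        {t \<in> standard_simplex n. realize G (step_fun v t) \<in> {x \<in> points G. classifying_map G' \<phi> x \<in> U}}"
      using U v' unfolding H.openin_classifying_space by auto
  qed auto
  then show ?thesis using img by (auto simp: continuous_map_def)
qed

section \<open>Path lifting\<close>

text \<open>
  Continuity of the lift refers to \<open>step_dist\<close> and not to the weak topology of \<open>EG\<close>: monodromy can
  be read off from distances.
\<close>

definition path_lift :: "'g monoid \<Rightarrow> (real \<Rightarrow> 'g cell_point set) \<Rightarrow> real \<Rightarrow> real \<Rightarrow> (real \<Rightarrow> real \<Rightarrow> 'g) \<Rightarrow> bool" where
  "path_lift G \<alpha> a b e \<longleftrightarrow> (\<forall>t\<in>{a..b}. e t \<in> step_functions G \<and> realize G (e t) = \<alpha> t \<and>
     (\<forall>\<epsilon>>0. \<exists>\<delta>>0. \<forall>t'\<in>{a..b}. \<bar>t' - t\<bar> < \<delta> \<longrightarrow> step_dist (e t') (e t) < \<epsilon>))"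

lemma path_liftD:
  assumes "path_lift G \<alpha> a b e" "t \<in> {a..b}"
  shows "e t \<in> step_functions G" "realize G (e t) = \<alpha> t"
  using assms by (auto simp: path_lift_def)

lemma path_lift_close:
  assumes "path_lift G \<alpha> a b e" "t \<in> {a..b}" "\<epsilon> > 0"
  obtains \<delta> where "\<delta> > 0" "\<And>t'. t' \<in> {a..b} \<Longrightarrow> \<bar>t' - t\<bar> < \<delta> \<Longrightarrow> step_dist (e t') (e t) < \<epsilon>"
  using assms unfolding path_lift_def by meson

lemma path_lift_concat:
  assumes e1: "path_lift G \<alpha> a b e1" and e2: "path_lift G \<alpha> b c e2" and eq: "e1 b = e2 b"
    and "a \<le> b" "b \<le> c"
  shows "path_lift G \<alpha> a c (\<lambda>t. if t \<le> b then e1 t else e2 t)" (is "path_lift G \<alpha> a c ?e")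
  unfolding path_lift_def
proof (intro ballI conjI allI impI)
  fix t assume t: "t \<in> {a..c}"
  show "?e t \<in> step_functions G" "realize G (?e t) = \<alpha> t"
    using path_liftD[OF e1, of t] path_liftD[OF e2, of t] t by auto
  fix \<epsilon> :: real assume \<epsilon>: "\<epsilon> > 0"
  have "\<exists>\<delta>>0. \<forall>t'\<in>{a..b}. \<bar>t' - t\<bar> < \<delta> \<longrightarrow> step_dist (?e t') (?e t) < \<epsilon>"
  proof (cases "t \<le> b")
    case True
    with t have "t \<in> {a..b}" by simp
    from path_lift_close[OF e1 this \<epsilon>] obtain \<delta> where
      "\<delta> > 0" "\<And>t'. t' \<in> {a..b} \<Longrightarrow> \<bar>t' - t\<bar> < \<delta> \<Longrightarrow> step_dist (e1 t') (e1 t) < \<epsilon>" by blast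
    then show ?thesis using True by (intro exI[of _ \<delta>]) auto
  qed (auto intro!: exI[of _ "t - b"])
  then obtain \<delta>1 where \<delta>1: "\<delta>1 > 0" "\<And>t'. t' \<in> {a..b} \<Longrightarrow> \<bar>t' - t\<bar> < \<delta>1 \<Longrightarrow> step_dist (?e t') (?e t) < \<epsilon>"
    by blast
  have "\<exists>\<delta>>0. \<forall>t'\<in>{b..c}. \<bar>t' - t\<bar> < \<delta> \<longrightarrow> step_dist (?e t') (?e t) < \<epsilon>"
  proof (cases "b \<le> t")
    case True
    have e2': "?e u = e2 u" if "b \<le> u" for u using that eq by auto
    from True t have "t \<in> {b..c}" by simp
    from path_lift_close[OF e2 this \<epsilon>] obtain \<delta> where
      "\<delta> > 0" "\<And>t'. t' \<in> {b..c} \<Longrightarrow> \<bar>t' - t\<bar> < \<delta> \<Longrightarrow> step_dist (e2 t') (e2 t) < \<epsilon>" by blast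
    then show ?thesis using True e2' eq by (intro exI[of _ \<delta>]) auto
  qed (auto intro!: exI[of _ "b - t"])
  then obtain \<delta>2 where \<delta>2: "\<delta>2 > 0" "\<And>t'. t' \<in> {b..c} \<Longrightarrow> \<bar>t' - t\<bar> < \<delta>2 \<Longrightarrow> step_dist (?e t') (?e t) < \<epsilon>"
    by blast
  show "\<exists>\<delta>>0. \<forall>t'\<in>{a..c}. \<bar>t' - t\<bar> < \<delta> \<longrightarrow> step_dist (?e t') (?e t) < \<epsilon>"
  proof (intro exI[of _ "min \<delta>1 \<delta>2"] conjI ballI impI)
    fix t' assume "t' \<in> {a..c}" "\<bar>t' - t\<bar> < min \<delta>1 \<delta>2"
    then show "step_dist (?e t') (?e t) < \<epsilon>" using \<delta>1(2)[of t'] \<delta>2(2)[of t'] by (cases "t' \<le> b") auto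
  qed (use \<delta>1(1) \<delta>2(1) in simp)
qed

lemma path_lift_map_step:
  fixes G :: "'g monoid" and Q :: "'q monoid"
  assumes "group G" "group Q" "\<phi> \<in> hom G Q" and e: "path_lift G \<alpha> a b e"
  shows "path_lift Q (\<lambda>t. classifying_map Q \<phi> (\<alpha> t)) a b (\<lambda>t. map_step \<phi> (e t))"
  unfolding path_lift_def
proof (intro ballI conjI allI impI)
  have c: "\<phi> \<in> carrier G \<rightarrow> carrier Q" using assms(3) by (rule hom_in_carrier[THEN funcsetI])
  fix t assume t: "t \<in> {a..b}"
  note et = path_liftD[OF e t]
  show "map_step \<phi> (e t) \<in> step_functions Q" by (rule map_step_in_step_functions[OF c et(1)])
  show "realize Q (map_step \<phi> (e t)) = classifying_map Q \<phi> (\<alpha> t)"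
    using classifying_map_realize[OF assms(1-3) et(1)] et(2) by simp
  fix \<epsilon> :: real assume \<epsilon>: "\<epsilon> > 0"
  obtain \<delta> where "\<delta> > 0" and \<delta>: "\<And>t'. t' \<in> {a..b} \<Longrightarrow> \<bar>t' - t\<bar> < \<delta> \<Longrightarrow> step_dist (e t') (e t) < \<epsilon>"
    using path_lift_close[OF e t \<epsilon>] by blast
  have "step_dist (map_step \<phi> (e t')) (map_step \<phi> (e t)) < \<epsilon>" if "t' \<in> {a..b}" "\<bar>t' - t\<bar> < \<delta>" for t'
    using step_dist_map_step[OF c path_liftD(1)[OF e that(1)] et(1)] \<delta>[OF that] by simp
  with \<open>\<delta> > 0\<close> show "\<exists>\<delta>>0. \<forall>t'\<in>{a..b}. \<bar>t' - t\<bar> < \<delta> \<longrightarrow> step_dist (map_step \<phi> (e t')) (map_step \<phi> (e t)) < \<epsilon>"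
    by blast
qed

context discrete_group
begin

lemma path_lift_translate:
  assumes e: "path_lift G \<alpha> a b e" and g: "g \<in> carrier G"
  shows "path_lift G \<alpha> a b (\<lambda>t. translate G g (e t))"
  unfolding path_lift_def
proof (intro ballI conjI allI impI)
  fix t assume t: "t \<in> {a..b}"
  note et = path_liftD[OF e t]
  show "translate G g (e t) \<in> step_functions G" "realize G (translate G g (e t)) = \<alpha> t"
    using et g by (auto simp: translate_in_step_functions realize_translate)
  fix \<epsilon> :: real assume \<epsilon>: "\<epsilon> > 0"
  obtain \<delta> where "\<delta> > 0" and \<delta>: "\<And>t'. t' \<in> {a..b} \<Longrightarrow> \<bar>t' - t\<bar> < \<delta> \<Longrightarrow> step_dist (e t') (e t) < \<epsilon>"
    using path_lift_close[OF e t \<epsilon>] by blast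
  have "step_dist (translate G g (e t')) (translate G g (e t)) < \<epsilon>" if "t' \<in> {a..b}" "\<bar>t' - t\<bar> < \<delta>" for t'
    using step_dist_translate[OF path_liftD(1)[OF e that(1)] et(1) g] \<delta>[OF that] by simp
  with \<open>\<delta> > 0\<close> show "\<exists>\<delta>>0. \<forall>t'\<in>{a..b}. \<bar>t' - t\<bar> < \<delta> \<longrightarrow> step_dist (translate G g (e t')) (translate G g (e t)) < \<epsilon>"
    by blast
qed

text \<open>
  If the projections of two lifts stay close, lifts that end close to each other also start close to
  each other.  On a short interval both lifts move little, so the lift of \<open>\<beta>\<close> that is close to \<open>e0\<close>
  at the left end is at distance less than \<open>1\<close> from \<open>e\<close> and hence equal to it; short intervals are
  assembled by bisection.  For equal paths this is uniqueness of lifts, for neighbouring paths it is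
  local constancy of the monodromy.
\<close>

lemma lift_nearby:
  assumes e0: "path_lift G \<alpha> 0 1 e0" and e: "path_lift G \<beta> 0 1 e"
    and near: "\<And>t. t \<in> {0..1} \<Longrightarrow> \<exists>h\<in>step_functions G. realize G h = \<beta> t \<and> step_dist h (e0 t) < 1/4"
    and "step_dist (e 1) (e0 1) < 1/4"
  shows "step_dist (e 0) (e0 0) < 1/4"
proof -
  define P where "P a b \<longleftrightarrow> (0 \<le> a \<longrightarrow> b \<le> 1 \<longrightarrow> step_dist (e b) (e0 b) < 1/4 \<longrightarrow> step_dist (e a) (e0 a) < 1/4)"
    for a b :: real
  have "(0::real) \<le> 1" by simp
  then have "P 0 1"
  proof (induction rule: Bolzano)
    case (local x)
    then have x: "x \<in> {0..1}" by simp
    \<comment> \<open>Each lift moves by less than \<open>1/8\<close> on the interval, so that \<open>h\<close> and \<open>e a\<close> will be closer than \<open>1/4 + 1/8 + 1/4 + 1/8\<close>.\<close>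
    obtain \<delta>0 where d0: "\<delta>0 > 0" "\<And>t'. t' \<in> {0..1} \<Longrightarrow> \<bar>t' - x\<bar> < \<delta>0 \<Longrightarrow> step_dist (e0 t') (e0 x) < 1/16"
      using path_lift_close[OF e0 x, of "1/16"] by auto
    obtain \<delta> where d: "\<delta> > 0" "\<And>t'. t' \<in> {0..1} \<Longrightarrow> \<bar>t' - x\<bar> < \<delta> \<Longrightarrow> step_dist (e t') (e x) < 1/16"
      using path_lift_close[OF e x, of "1/16"] by auto
    have "P a b" if ab: "a \<le> x" "x \<le> b" "b - a < min \<delta> \<delta>0" for a b
      unfolding P_def
    proof (intro impI)
      assume "0 \<le> a" "b \<le> 1" and hyp: "step_dist (e b) (e0 b) < 1/4"
      then have a: "a \<in> {0..1}" and b: "b \<in> {0..1}" using ab by auto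
      note s = path_liftD(1)[OF e] path_liftD(1)[OF e0]
      obtain h where h: "h \<in> step_functions G" "realize G h = \<beta> a" "step_dist h (e0 a) < 1/4"
        using near[OF a] by blast
      have "step_dist (e0 a) (e0 b) < 1/8" "step_dist (e b) (e a) < 1/8"
        using step_dist_triangle[OF s(2)[OF a] s(2)[OF x] s(2)[OF b]] d0(2)[OF a] d0(2)[OF b]
          step_dist_triangle[OF s(1)[OF b] s(1)[OF x] s(1)[OF a]] d(2)[OF a] d(2)[OF b] ab
          step_dist_sym[of "e0 x"] step_dist_sym[of "e x"]
        by auto
      then have "step_dist h (e a) < 1"
        using step_dist_triangle[OF h(1) s(2)[OF a] s(1)[OF a]] h(3)
          step_dist_triangle[OF s(2)[OF a] s(2)[OF b] s(1)[OF a]]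
          step_dist_triangle[OF s(2)[OF b] s(1)[OF b] s(1)[OF a]] hyp step_dist_sym[of "e0 b"] by force
      then have "h = e a" using h path_liftD[OF e a] by (intro near_lift_unique) auto
      then show "step_dist (e a) (e0 a) < 1/4" using h by simp
    qed
    then show ?case using d(1) d0(1) by (intro exI[of _ "min \<delta> \<delta>0"]) auto
  qed (auto simp: P_def)
  then show ?thesis using assms(4) by (simp add: P_def)
qed

lemma path_lift_unique:
  assumes "path_lift G \<alpha> 0 1 e" "path_lift G \<alpha> 0 1 e'" "e 1 = e' 1"
  shows "e 0 = e' 0"
proof -
  have "step_dist (e 0) (e' 0) < 1/4"
  proof (rule lift_nearby[OF assms(2,1)])
    fix t :: real assume "t \<in> {0..1}"
    then show "\<exists>h\<in>step_functions G. realize G h = \<alpha> t \<and> step_dist h (e' t) < 1/4"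
      using path_liftD[OF assms(2)] by (intro bexI[of _ "e' t"]) auto
  qed (simp add: assms(3))
  then show ?thesis
    using path_liftD[OF assms(1), of 0] path_liftD[OF assms(2), of 0] by (intro near_lift_unique) auto
qed

lemma path_near:
  assumes \<alpha>: "continuous_map (top_of_set {0..1}) (classifying_space G) \<alpha>"
    and t: "t \<in> {0..1::real}" and f: "f \<in> step_functions G" "realize G f = \<alpha> t" and \<epsilon>: "\<epsilon> > 0"
  obtains \<delta> where "\<delta> > 0"
    "\<And>t'. t' \<in> {0..1} \<Longrightarrow> \<bar>t' - t\<bar> < \<delta> \<Longrightarrow> \<exists>h\<in>step_functions G. realize G h = \<alpha> t' \<and> step_dist h f < \<epsilon>"
proof -
  let ?N = "{realize G h | h. h \<in> step_functions G \<and> step_dist h f < \<epsilon>}"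
  have "openin (top_of_set {0..1}) {t' \<in> topspace (top_of_set {0..1}). \<alpha> t' \<in> ?N}"
    using \<alpha> openin_near[OF f(1)] by (rule openin_continuous_map_preimage)
  moreover have "t \<in> {t' \<in> topspace (top_of_set {0..1}). \<alpha> t' \<in> ?N}"
    using t f \<epsilon> by (auto intro!: exI[of _ f])
  ultimately obtain \<delta> where "\<delta> > 0" and \<delta>: "ball t \<delta> \<inter> {0..1} \<subseteq> {t' \<in> topspace (top_of_set {0..1}). \<alpha> t' \<in> ?N}"
    unfolding openin_contains_ball by blast
  show thesis
  proof (rule that[OF \<open>\<delta> > 0\<close>])
    fix t' :: real assume "t' \<in> {0..1}" "\<bar>t' - t\<bar> < \<delta>"
    then have "t' \<in> ball t \<delta> \<inter> {0..1}" by (auto simp: dist_real_def)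
    with \<delta> have "\<alpha> t' \<in> ?N" by blast
    then show "\<exists>h\<in>step_functions G. realize G h = \<alpha> t' \<and> step_dist h f < \<epsilon>" by force
  qed
qed

text \<open>
  On a short interval the lift is forced: it consists of the lifts in a small ball around one fixed
  step function \<open>k'\<close>, and it is continuous because the lifts near any of its values are themselves
  close to \<open>k'\<close>.  Short intervals are again assembled by bisection.
\<close>

lemma path_lift_exists:
  assumes \<alpha>: "continuous_map (top_of_set {0..1}) (classifying_space G) \<alpha>"
    and f: "f \<in> step_functions G" "realize G f = \<alpha> 1"
  obtains e where "path_lift G \<alpha> 0 1 e" "e 1 = f"
proof -
  define P where "P a b \<longleftrightarrow> (0 \<le> a \<longrightarrow> b \<le> 1 \<longrightarrow>
      (\<forall>f\<in>step_functions G. realize G f = \<alpha> b \<longrightarrow> (\<exists>e. path_lift G \<alpha> a b e \<and> e b = f)))" for a b :: real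
  have "(0::real) \<le> 1" by simp
  then have "P 0 1"
  proof (induction rule: Bolzano)
    case (trans a b c)
    show ?case unfolding P_def
    proof (intro impI ballI)
      fix f assume "0 \<le> a" "c \<le> 1" and f: "f \<in> step_functions G" "realize G f = \<alpha> c"
      then obtain e2 where e2: "path_lift G \<alpha> b c e2" "e2 c = f"
        using trans unfolding P_def by force
      have "e2 b \<in> step_functions G" "realize G (e2 b) = \<alpha> b" using path_liftD[OF e2(1), of b] trans by auto
      then obtain e1 where e1: "path_lift G \<alpha> a b e1" "e1 b = e2 b"
        using trans \<open>0 \<le> a\<close> \<open>c \<le> 1\<close> unfolding P_def by force
      have "(if c \<le> b then e1 c else e2 c) = f" using e1(2) e2(2) trans by auto
      then show "\<exists>e. path_lift G \<alpha> a c e \<and> e c = f"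
        using path_lift_concat[OF e1(1) e2(1) e1(2)] trans by blast
    qed
  next
    case (local x)
    then have x: "x \<in> {0..1}" by simp
    then have "\<alpha> x \<in> points G" using continuous_map_image_subset_topspace[OF \<alpha>] by auto
    then obtain k where k: "k \<in> step_functions G" "\<alpha> x = realize G k" by (rule realize_onto)
    obtain \<delta> where "\<delta> > 0" and \<delta>: "\<And>t'. t' \<in> {0..1} \<Longrightarrow> \<bar>t' - x\<bar> < \<delta> \<Longrightarrow>
        \<exists>h\<in>step_functions G. realize G h = \<alpha> t' \<and> step_dist h k < 1/8"
      using path_near[OF \<alpha> x k(1) k(2)[symmetric], of "1/8"] by auto
    have "P a b" if ab: "a \<le> x" "x \<le> b" "b - a < \<delta>" for a b
      unfolding P_def
    proof (intro impI ballI)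
      fix f assume "0 \<le> a" "b \<le> 1" and f: "f \<in> step_functions G" "realize G f = \<alpha> b"
      obtain h where h: "h \<in> step_functions G" "realize G h = \<alpha> b" "step_dist h k < 1/8"
        using \<delta>[of b] ab \<open>0 \<le> a\<close> \<open>b \<le> 1\<close> by auto
      obtain g where g: "g \<in> carrier G" "f = translate G g h"
        using realize_eq_iff[OF h(1) f(1)] h(2) f(2) by auto
      \<comment> \<open>The ball around \<open>k\<close> is moved to the sheet of \<open>f\<close>.\<close>
      define k' where "k' = translate G g k"
      have k': "k' \<in> step_functions G" using k g by (simp add: k'_def translate_in_step_functions)
      have "\<exists>h\<in>step_functions G. realize G h = \<alpha> t \<and> step_dist h k' < 1/8" if t: "t \<in> {a..b}" for t
      proof -
        have "t \<in> {0..1}" "\<bar>t - x\<bar> < \<delta>" using ab t \<open>0 \<le> a\<close> \<open>b \<le> 1\<close> by (auto simp: abs_if)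
        then obtain h where h: "h \<in> step_functions G" "realize G h = \<alpha> t" "step_dist h k < 1/8"
          using \<delta> by blast
        then show ?thesis
          using k g by (intro bexI[of _ "translate G g h"])
            (auto simp: k'_def step_dist_translate realize_translate translate_in_step_functions)
      qed
      then obtain e where e: "\<And>t. t \<in> {a..b} \<Longrightarrow> e t \<in> step_functions G \<and> realize G (e t) = \<alpha> t \<and> step_dist (e t) k' < 1/8"
        by metis
      \<comment> \<open>As \<open>e t\<close> is within \<open>1/8\<close> of \<open>k'\<close>, the distance of \<open>h\<close> and \<open>e t\<close> is less than \<open>1\<close>.\<close>
      have unique: "h = e t" if "t \<in> {a..b}" "h \<in> step_functions G" "realize G h = \<alpha> t" "step_dist h k' < 7/8" for h t
        using step_dist_triangle[OF that(2) k', of "e t"] e[OF that(1)] that step_dist_sym[of k' "e t"]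
        by (intro near_lift_unique) auto
      have "f = e b"
        using f h g k ab by (intro unique) (auto simp: k'_def step_dist_translate)
      moreover have "path_lift G \<alpha> a b e"
        unfolding path_lift_def
      proof (intro ballI conjI allI impI)
        fix t assume t: "t \<in> {a..b}"
        show et: "e t \<in> step_functions G" "realize G (e t) = \<alpha> t" using e[OF t] by auto
        fix \<epsilon> :: real assume \<epsilon>: "\<epsilon> > 0"
        have t01: "t \<in> {0..1}" using t \<open>0 \<le> a\<close> \<open>b \<le> 1\<close> by auto
        obtain \<delta>' where "\<delta>' > 0" and \<delta>': "\<And>t'. t' \<in> {0..1} \<Longrightarrow> \<bar>t' - t\<bar> < \<delta>' \<Longrightarrow>
            \<exists>h\<in>step_functions G. realize G h = \<alpha> t' \<and> step_dist h (e t) < min \<epsilon> (1/8)"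
          using path_near[OF \<alpha> t01 et, of "min \<epsilon> (1/8)"] \<epsilon> by auto
        have "step_dist (e t') (e t) < \<epsilon>" if t': "t' \<in> {a..b}" "\<bar>t' - t\<bar> < \<delta>'" for t'
        proof -
          obtain h where h: "h \<in> step_functions G" "realize G h = \<alpha> t'" "step_dist h (e t) < min \<epsilon> (1/8)"
            using \<delta>'[of t'] t' \<open>0 \<le> a\<close> \<open>b \<le> 1\<close> by auto
          have "step_dist h k' < 7/8"
            using step_dist_triangle[OF h(1) et(1) k'] e[OF t] h(3) by auto
          then have "h = e t'" using h t' by (intro unique) auto
          then show ?thesis using h by simp
        qed
        then show "\<exists>\<delta>>0. \<forall>t'\<in>{a..b}. \<bar>t' - t\<bar> < \<delta> \<longrightarrow> step_dist (e t') (e t) < \<epsilon>"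
          using \<open>\<delta>' > 0\<close> by blast
      qed
      ultimately show "\<exists>e. path_lift G \<alpha> a b e \<and> e b = f" by blast
    qed
    then show ?case using \<open>\<delta> > 0\<close> by blast
  qed
  then show thesis using f that unfolding P_def by auto
qed

end

section \<open>From a section to an isomorphism of bundles\<close>

text \<open>
  An arbitrary split homomorphism takes the place of the projection of a semi-direct product, so that
  composites of two such projections are covered as well.
\<close>

locale split_projection = G: discrete_group G + Q: discrete_group Q
  for G :: "'g monoid" and Q :: "'q monoid" +
  fixes p :: "'g \<Rightarrow> 'q" and s :: "'q \<Rightarrow> 'g"
  assumes p: "p \<in> hom G Q" and s: "s \<in> hom Q G"
    and split: "\<And>q. q \<in> carrier Q \<Longrightarrow> p (s q) = q"
begin

definition \<rho> :: "'g \<Rightarrow> 'g" where "\<rho> g = s (p g)"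

text \<open>
  An isomorphism over \<open>U\<close> from the pullback of the principal bundle \<open>EG \<rightarrow> BG\<close> along \<open>B\<rho>\<close> to \<open>EG\<close>
  itself, which induces the identity on the associated bundles with group \<open>Q\<close>.  It is given by
  the element \<open>\<gamma> f\<close> that carries \<open>\<rho> \<circ> f\<close>, which lies over \<open>B\<rho>\<close> of the point below \<open>f\<close>, to the sheet of
  \<open>f\<close>.  Since the structure group is discrete, \<open>\<gamma>\<close> is locally constant; near \<open>f\<close> means that the
  point below is in \<open>N\<close> and that the lift is in the sheet of \<open>f\<close>, which the bound \<open>1/4\<close> singles out.
\<close>

definition bundle_iso :: "'g cell_point set set \<Rightarrow> ((real \<Rightarrow> 'g) \<Rightarrow> 'g) \<Rightarrow> bool" where
  "bundle_iso U \<gamma> \<longleftrightarrow>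
    (\<forall>f\<in>step_functions G. realize G f \<in> U \<longrightarrow>
       \<gamma> f \<in> carrier G \<and> p (\<gamma> f) = \<one>\<^bsub>Q\<^esub> \<and>
       (\<forall>g\<in>carrier G. \<gamma> (translate G g f) = g \<otimes>\<^bsub>G\<^esub> \<gamma> f \<otimes>\<^bsub>G\<^esub> inv\<^bsub>G\<^esub> (\<rho> g)) \<and>
       (\<exists>N. openin (classifying_space G) N \<and> realize G f \<in> N \<and> N \<subseteq> U \<and>
          (\<forall>h\<in>step_functions G. realize G h \<in> N \<longrightarrow> step_dist h f < 1/4 \<longrightarrow> \<gamma> h = \<gamma> f)))"

abbreviation path_space :: "(real \<Rightarrow> 'g cell_point set) topology" where
  "path_space \<equiv> fibrewise_path_space (classifying_space G) (classifying_map Q p) (classifying_map G s)"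

definition has_section :: "'g cell_point set set \<Rightarrow> bool" where
  "has_section U \<longleftrightarrow> (\<exists>\<sigma>. continuous_map (subtopology (classifying_space G) U) path_space \<sigma> \<and>
     (\<forall>y\<in>U. \<sigma> y 1 = y))"

lemma p_carrier: "p \<in> carrier G \<rightarrow> carrier Q" using p by (rule hom_in_carrier[THEN funcsetI])
lemma \<rho>_hom: "\<rho> \<in> hom G G"
  using hom_compose[OF p s] unfolding \<rho>_def by (simp add: comp_def)

lemma \<rho>_carrier: "\<rho> \<in> carrier G \<rightarrow> carrier G" using \<rho>_hom by (rule hom_in_carrier[THEN funcsetI])

lemma p_\<rho>: "g \<in> carrier G \<Longrightarrow> p (\<rho> g) = p g"
  using p_carrier split by (auto simp: \<rho>_def)

lemma map_step_p_\<rho>: "f \<in> step_functions G \<Longrightarrow> map_step p (map_step \<rho> f) = map_step p f"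
  unfolding map_step_def by (rule restrict_ext) (simp add: p_\<rho> step_function_carrier)

lemma classifying_map_s_p:
  assumes "f \<in> step_functions G"
  shows "classifying_map G s (classifying_map Q p (realize G f)) = realize G (map_step \<rho> f)"
proof -
  have "map_step s (map_step p f) = map_step \<rho> f"
    by (rule ext) (simp add: map_step_def \<rho>_def)
  then show ?thesis
    using map_step_in_step_functions[OF p_carrier assms]
    by (simp add: classifying_map_realize[OF G.group_axioms Q.group_axioms p assms]
        classifying_map_realize[OF Q.group_axioms G.group_axioms s])
qed

lemma topspace_path_space:
  assumes "\<alpha> \<in> topspace path_space"
  shows "continuous_map (top_of_set {0..1}) (classifying_space G) \<alpha>"
    "\<And>u. u \<in> {0..1} \<Longrightarrow> classifying_map Q p (\<alpha> u) = classifying_map Q p (\<alpha> 0)"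
    "\<alpha> 0 = classifying_map G s (classifying_map Q p (\<alpha> 0))"
  using assms
  unfolding fibrewise_path_space_def compact_open_topology_def topology_generated_by_topspace topspace_subtopology
  by blast+

context
  fixes U \<sigma>
  assumes U: "openin (classifying_space G) U"
    and \<sigma>: "continuous_map (subtopology (classifying_space G) U) path_space \<sigma>"
    and \<sigma>1: "\<And>y. y \<in> U \<Longrightarrow> \<sigma> y 1 = y"
begin

lemma section_path:
  assumes "y \<in> U"
  shows "continuous_map (top_of_set {0..1}) (classifying_space G) (\<sigma> y)"
    "\<And>u. u \<in> {0..1} \<Longrightarrow> classifying_map Q p (\<sigma> y u) = classifying_map Q p (\<sigma> y 0)"
    "\<sigma> y 0 = classifying_map G s (classifying_map Q p (\<sigma> y 0))"
proof -
  have "\<sigma> y \<in> topspace path_space"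
    using continuous_map_image_subset_topspace[OF \<sigma>] openin_subset[OF U] assms by auto
  note topspace_path_space[OF this]
  then show "continuous_map (top_of_set {0..1}) (classifying_space G) (\<sigma> y)"
    "\<And>u. u \<in> {0..1} \<Longrightarrow> classifying_map Q p (\<sigma> y u) = classifying_map Q p (\<sigma> y 0)"
    "\<sigma> y 0 = classifying_map G s (classifying_map Q p (\<sigma> y 0))" by blast+
qed

lemma section_preimage_open:
  assumes C: "compactin (top_of_set {0..1}) C" and W: "openin (classifying_space G) W"
  shows "openin (classifying_space G) {y \<in> U. \<sigma> y ` C \<subseteq> W}"
proof -
  let ?O = "{\<alpha> \<in> extensional (topspace (top_of_set {0..1})).
      continuous_map (top_of_set {0..1}) (classifying_space G) \<alpha> \<and> \<alpha> ` C \<subseteq> W}"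
  have c: "continuous_map (subtopology (classifying_space G) U)
     (compact_open_topology (top_of_set {0..1}) (classifying_space G)) \<sigma>"
    using \<sigma> unfolding fibrewise_path_space_def by (rule continuous_map_into_fulltopology)
  have "openin (compact_open_topology (top_of_set {0..1}) (classifying_space G)) ?O"
    unfolding compact_open_topology_def by (rule topology_generated_by_Basis) (use C W in blast)
  from openin_continuous_map_preimage[OF c this]
  have "openin (classifying_space G) {y \<in> topspace (subtopology (classifying_space G) U). \<sigma> y \<in> ?O}"
    unfolding openin_open_subtopology[OF U] by blast
  also have "{y \<in> topspace (subtopology (classifying_space G) U). \<sigma> y \<in> ?O} = {y \<in> U. \<sigma> y ` C \<subseteq> W}"
  proof -
    have "\<sigma> y \<in> extensional (topspace (top_of_set {0..1}))" if "y \<in> U" for y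
    proof -
      have "\<sigma> y \<in> topspace (compact_open_topology (top_of_set {0..1}) (classifying_space G))"
        using continuous_map_image_subset_topspace[OF c] openin_subset[OF U] that by auto
      then show ?thesis unfolding compact_open_topology_def topology_generated_by_topspace by auto
    qed
    then show ?thesis using section_path(1) openin_subset[OF U] by auto
  qed
  finally show ?thesis .
qed

text \<open>
  Continuity into the compact-open topology gives, around each time \<open>x\<close>, a short interval and a
  neighbourhood of \<open>y0\<close> whose paths stay close to \<open>e0\<close> on that interval; compactness of the unit interval
  is used in the form of bisection.
\<close>

lemma section_uniformly_near:
  assumes y0: "y0 \<in> U" and e0: "path_lift G (\<sigma> y0) 0 1 e0"
  obtains N where "openin (classifying_space G) N" "y0 \<in> N" "N \<subseteq> U"
    "\<And>y t. y \<in> N \<Longrightarrow> t \<in> {0..1} \<Longrightarrow> \<exists>h\<in>step_functions G. realize G h = \<sigma> y t \<and> step_dist h (e0 t) < 1/4"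
proof -
  define P where "P a b \<longleftrightarrow> (0 \<le> a \<longrightarrow> b \<le> 1 \<longrightarrow> (\<exists>N. openin (classifying_space G) N \<and> y0 \<in> N \<and> N \<subseteq> U \<and>
    (\<forall>y\<in>N. \<forall>t\<in>{a..b}. \<exists>h\<in>step_functions G. realize G h = \<sigma> y t \<and> step_dist h (e0 t) < 1/4)))" for a b
  have "(0::real) \<le> 1" by simp
  then have "P 0 1"
  proof (induction rule: Bolzano)
    case (trans a b c)
    show ?case unfolding P_def
    proof (intro impI)
      assume "0 \<le> a" "c \<le> 1"
      then obtain N1 N2 where N:
        "openin (classifying_space G) N1" "y0 \<in> N1" "N1 \<subseteq> U"
        "\<And>y t. y\<in>N1 \<Longrightarrow> t\<in>{a..b} \<Longrightarrow> \<exists>h\<in>step_functions G. realize G h = \<sigma> y t \<and> step_dist h (e0 t) < 1/4"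
        "openin (classifying_space G) N2" "y0 \<in> N2" "N2 \<subseteq> U"
        "\<And>y t. y\<in>N2 \<Longrightarrow> t\<in>{b..c} \<Longrightarrow> \<exists>h\<in>step_functions G. realize G h = \<sigma> y t \<and> step_dist h (e0 t) < 1/4"
        using trans unfolding P_def by force
      have "\<exists>h\<in>step_functions G. realize G h = \<sigma> y t \<and> step_dist h (e0 t) < 1/4"
        if "y \<in> N1 \<inter> N2" "t \<in> {a..c}" for y t
        using N(4)[of y t] N(8)[of y t] that by (cases "t \<le> b") auto
      then show "\<exists>N. openin (classifying_space G) N \<and> y0 \<in> N \<and> N \<subseteq> U \<and>
        (\<forall>y\<in>N. \<forall>t\<in>{a..c}. \<exists>h\<in>step_functions G. realize G h = \<sigma> y t \<and> step_dist h (e0 t) < 1/4)"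
        using N(1-3,5-7) by (intro exI[of _ "N1 \<inter> N2"]) auto
    qed
  next
    case (local x)
    then have x: "x \<in> {0..1}" by simp
    let ?W = "{realize G h | h. h \<in> step_functions G \<and> step_dist h (e0 x) < 1/8}"
    note e0x = path_liftD[OF e0 x]
    obtain \<delta> where \<delta>: "\<delta> > 0" "\<And>t'. t' \<in> {0..1} \<Longrightarrow> \<bar>t' - x\<bar> < \<delta> \<Longrightarrow>
        \<exists>h\<in>step_functions G. realize G h = \<sigma> y0 t' \<and> step_dist h (e0 x) < 1/8"
      using G.path_near[OF section_path(1)[OF y0] x e0x, of "1/8"] by auto
    obtain \<delta>0 where \<delta>0: "\<delta>0 > 0" "\<And>t'. t' \<in> {0..1} \<Longrightarrow> \<bar>t' - x\<bar> < \<delta>0 \<Longrightarrow> step_dist (e0 t') (e0 x) < 1/8"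
      using path_lift_close[OF e0 x, of "1/8"] by auto
    have "P a b" if ab: "a \<le> x" "x \<le> b" "b - a < min \<delta> \<delta>0" for a b
      unfolding P_def
    proof (intro impI)
      assume ab01: "0 \<le> a" "b \<le> 1"
      define N where "N = {y \<in> U. \<sigma> y ` {a..b} \<subseteq> ?W}"
      have "compactin (top_of_set {0..1}) {a..b}" using ab01 by (auto simp: compactin_subtopology)
      then have "openin (classifying_space G) N"
        unfolding N_def by (rule section_preimage_open) (rule G.openin_near[OF e0x(1)])
      moreover have "y0 \<in> N"
      proof -
        have "\<sigma> y0 t \<in> ?W" if "t \<in> {a..b}" for t using \<delta>(2)[of t] that ab ab01 by force
        then show ?thesis using y0 by (auto simp: N_def)
      qed
      moreover have "\<exists>h\<in>step_functions G. realize G h = \<sigma> y t \<and> step_dist h (e0 t) < 1/4"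
        if y: "y \<in> N" and t: "t \<in> {a..b}" for y t
      proof -
        obtain h where h: "h \<in> step_functions G" "\<sigma> y t = realize G h" "step_dist h (e0 x) < 1/8"
          using y t unfolding N_def by blast
        have t01: "t \<in> {0..1}" and "\<bar>t - x\<bar> < \<delta>0" using t ab ab01 by auto
        then have "step_dist (e0 t) (e0 x) < 1/8" by (rule \<delta>0(2))
        then have "step_dist h (e0 t) < 1/4"
          using step_dist_triangle[OF h(1) e0x(1) path_liftD(1)[OF e0 t01]] h(3) step_dist_sym[of "e0 t"] by simp
        then show ?thesis using h by auto
      qed
      ultimately show "\<exists>N. openin (classifying_space G) N \<and> y0 \<in> N \<and> N \<subseteq> U \<and>
        (\<forall>y\<in>N. \<forall>t\<in>{a..b}. \<exists>h\<in>step_functions G. realize G h = \<sigma> y t \<and> step_dist h (e0 t) < 1/4)"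
        by (intro exI[of _ N]) (auto simp: N_def)
    qed
    then show ?case using \<delta>(1) \<delta>0(1) by (intro exI[of _ "min \<delta> \<delta>0"]) auto
  qed
  then show thesis using that unfolding P_def by force
qed

text \<open>
  The path \<open>\<sigma> (realize G f)\<close> leads from \<open>B\<rho>\<close> of the point below \<open>f\<close> to that point.  Its lift that
  ends at \<open>f\<close> starts at a translate of \<open>\<rho> \<circ> f\<close>, and \<open>\<gamma> f\<close> is the translating element.
  Uniqueness of lifts gives equivariance, and, applied in \<open>EQ\<close> to the image of the lift, which covers
  a constant path, it gives \<open>p (\<gamma> f) = \<one>\<close>.
\<close>

lemma section_imp_bundle_iso: "\<exists>\<gamma>. bundle_iso U \<gamma>"
proof -
  \<comment> \<open>The relation that defines \<open>\<gamma>\<close>, kept separate so that uniqueness can be applied to other candidates.\<close>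
  define R where "R f g \<longleftrightarrow> g \<in> carrier G \<and> (\<exists>e. path_lift G (\<sigma> (realize G f)) 0 1 e \<and> e 1 = f \<and>
      e 0 = translate G g (map_step \<rho> f))" for f g
  have \<rho>s: "map_step \<rho> f \<in> step_functions G" if "f \<in> step_functions G" for f
    using \<rho>_carrier that by (rule map_step_in_step_functions)
  have R_ex: "\<exists>g. R f g" if f: "f \<in> step_functions G" "realize G f \<in> U" for f
  proof -
    obtain e where e: "path_lift G (\<sigma> (realize G f)) 0 1 e" "e 1 = f"
      using G.path_lift_exists[OF section_path(1)[OF f(2)] f(1)] \<sigma>1[OF f(2)] by auto
    have "\<sigma> (realize G f) 0 = classifying_map G s (classifying_map Q p (realize G f))"
      using section_path(3)[OF f(2)] section_path(2)[OF f(2), of 1] \<sigma>1[OF f(2)] by simp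
    then have "realize G (map_step \<rho> f) = realize G (e 0)"
      using path_liftD(2)[OF e(1), of 0] classifying_map_s_p[OF f(1)] by simp
    then show ?thesis
      using G.realize_eq_iff[OF \<rho>s[OF f(1)] path_liftD(1)[OF e(1), of 0]] e unfolding R_def by auto
  qed
  have R_unique: "g = g'" if "R f g" "R f g'" and f: "f \<in> step_functions G" for f g g'
  proof -
    have "translate G g (map_step \<rho> f) = translate G g' (map_step \<rho> f)"
      using that G.path_lift_unique unfolding R_def by metis
    then show ?thesis using that(1,2) G.translate_inject[OF \<rho>s[OF f]] unfolding R_def by simp
  qed
  define \<gamma> where "\<gamma> f = (SOME g. R f g)" for f
  have \<gamma>: "R f (\<gamma> f)" if "f \<in> step_functions G" "realize G f \<in> U" for f
    unfolding \<gamma>_def using R_ex[OF that] by (rule someI_ex)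
  have "bundle_iso U \<gamma>"
    unfolding bundle_iso_def
  proof (intro ballI impI conjI)
    fix f assume f: "f \<in> step_functions G" "realize G f \<in> U"
    obtain e where e: "path_lift G (\<sigma> (realize G f)) 0 1 e" "e 1 = f" "e 0 = translate G (\<gamma> f) (map_step \<rho> f)"
      and c: "\<gamma> f \<in> carrier G" using \<gamma>[OF f] unfolding R_def by auto
    show "\<gamma> f \<in> carrier G" by fact
    show "p (\<gamma> f) = \<one>\<^bsub>Q\<^esub>"
    proof -
      have pf: "map_step p f \<in> step_functions Q" using p_carrier f(1) by (rule map_step_in_step_functions)
      have "path_lift Q (\<lambda>t. classifying_map Q p (\<sigma> (realize G f) t)) 0 1 (\<lambda>t. map_step p (e t))"
        by (rule path_lift_map_step[OF G.group_axioms Q.group_axioms p e(1)])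
      moreover have const: "classifying_map Q p (\<sigma> (realize G f) t) = realize Q (map_step p f)" if "t \<in> {0..1}" for t
        using section_path(2)[OF f(2), of t] section_path(2)[OF f(2), of 1] \<sigma>1[OF f(2)] that
          classifying_map_realize[OF G.group_axioms Q.group_axioms p f(1)] by simp
      have "path_lift Q (\<lambda>t. classifying_map Q p (\<sigma> (realize G f) t)) 0 1 (\<lambda>t. map_step p f)"
        unfolding path_lift_def using pf const by (auto intro: exI[of _ 1])
      ultimately have "map_step p (e 0) = map_step p f"
        using Q.path_lift_unique e(2) by blast
      then have "translate Q (p (\<gamma> f)) (map_step p f) = translate Q \<one>\<^bsub>Q\<^esub> (map_step p f)"
        using e(3) map_step_translate[OF p \<rho>s[OF f(1)] c] map_step_p_\<rho>[OF f(1)] Q.translate_one[OF pf] by simp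
      then show ?thesis using Q.translate_inject[OF pf] hom_in_carrier[OF p c] by simp
    qed
    show "\<gamma> (translate G g f) = g \<otimes>\<^bsub>G\<^esub> \<gamma> f \<otimes>\<^bsub>G\<^esub> inv\<^bsub>G\<^esub> (\<rho> g)" if g: "g \<in> carrier G" for g
    proof -
      have f': "translate G g f \<in> step_functions G" "realize G (translate G g f) = realize G f"
        using f g by (auto simp: G.translate_in_step_functions G.realize_translate)
      have \<rho>g: "\<rho> g \<in> carrier G" using \<rho>_carrier g by auto
      have "path_lift G (\<sigma> (realize G f)) 0 1 (\<lambda>t. translate G g (e t))"
        by (rule G.path_lift_translate[OF e(1) g])
      moreover have "translate G g (e 0) = translate G (g \<otimes>\<^bsub>G\<^esub> \<gamma> f \<otimes>\<^bsub>G\<^esub> inv\<^bsub>G\<^esub> (\<rho> g)) (map_step \<rho> (translate G g f))"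
        using c g \<rho>g \<rho>s[OF f(1)] e(3)
        by (simp add: map_step_translate[OF \<rho>_hom f(1) g] G.translate_translate G.m_assoc)
      ultimately have "R (translate G g f) (g \<otimes>\<^bsub>G\<^esub> \<gamma> f \<otimes>\<^bsub>G\<^esub> inv\<^bsub>G\<^esub> (\<rho> g))"
        unfolding R_def f'(2) using e(2) g c \<rho>g by (auto intro!: exI[of _ "\<lambda>t. translate G g (e t)"])
      then show ?thesis using R_unique \<gamma>[OF f'(1)] f' f(2) by metis
    qed
    obtain N where N: "openin (classifying_space G) N" "realize G f \<in> N" "N \<subseteq> U"
      "\<And>y t. y \<in> N \<Longrightarrow> t \<in> {0..1} \<Longrightarrow> \<exists>h\<in>step_functions G. realize G h = \<sigma> y t \<and> step_dist h (e t) < 1/4"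
      using section_uniformly_near[OF f(2) e(1)] by blast
    have "\<gamma> h = \<gamma> f" if h: "h \<in> step_functions G" "realize G h \<in> N" "step_dist h f < 1/4" for h
    proof -
      have hU: "realize G h \<in> U" using h N by blast
      obtain e' where e': "path_lift G (\<sigma> (realize G h)) 0 1 e'" "e' 1 = h" "e' 0 = translate G (\<gamma> h) (map_step \<rho> h)"
        and c': "\<gamma> h \<in> carrier G" using \<gamma>[OF h(1) hU] unfolding R_def by auto
      have "step_dist (e' 0) (e 0) < 1/4"
        using N(4)[OF h(2)] h(3) e' e by (intro G.lift_nearby[OF e(1) e'(1)]) auto
      moreover have "step_dist (translate G (\<gamma> h) (map_step \<rho> f)) (e' 0) < 1/4"
        unfolding e'(3) G.step_dist_translate[OF \<rho>s[OF f(1)] \<rho>s[OF h(1)] c']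
        using step_dist_map_step[OF \<rho>_carrier f(1) h(1)] h(3) step_dist_sym[of f h] by simp
      ultimately have "step_dist (translate G (\<gamma> h) (map_step \<rho> f)) (e 0) < 1"
        using step_dist_triangle[OF G.translate_in_step_functions[OF \<rho>s[OF f(1)] c']
          path_liftD(1)[OF e'(1), of 0] path_liftD(1)[OF e(1), of 0]] by simp
      then show ?thesis unfolding e(3) by (intro G.translate_inject[OF \<rho>s[OF f(1)] c' c])
    qed
    then show "\<exists>N. openin (classifying_space G) N \<and> realize G f \<in> N \<and> N \<subseteq> U \<and>
          (\<forall>h\<in>step_functions G. realize G h \<in> N \<longrightarrow> step_dist h f < 1/4 \<longrightarrow> \<gamma> h = \<gamma> f)"
      using N(1-3) by blast
  qed
  then show ?thesis by blast
qed

end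

end

section \<open>From an isomorphism of bundles to a section\<close>

text \<open>
  The path \<open>\<tau> \<mapsto> splice \<tau> f h\<close> from \<open>h\<close> to \<open>f\<close> contracts \<open>EG\<close> without any choices.  If \<open>f\<close> and \<open>h\<close>
  have the same partition \<open>t\<close>, the path runs inside the simplex spanned by the vertices of both: its
  coordinates are the lengths of the intervals of \<open>t\<close> before \<open>\<tau>\<close>, followed by the lengths of
  the intervals of \<open>t\<close> after \<open>\<tau>\<close>.
\<close>

definition splice :: "real \<Rightarrow> (real \<Rightarrow> 'g) \<Rightarrow> (real \<Rightarrow> 'g) \<Rightarrow> real \<Rightarrow> 'g" where
  "splice \<tau> f h = (\<lambda>u\<in>{0..<1}. if u < \<tau> then f u else h u)"

definition splice_vertices :: "nat \<Rightarrow> (nat \<Rightarrow> 'g) \<Rightarrow> (nat \<Rightarrow> 'g) \<Rightarrow> nat \<Rightarrow> 'g" where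
  "splice_vertices n v w i = (if i \<le> n then v i else w (i - Suc n))"

definition splice_weights :: "nat \<Rightarrow> (nat \<Rightarrow> real) \<Rightarrow> real \<Rightarrow> nat \<Rightarrow> real" where
  "splice_weights n t \<tau> i =
     (if i \<le> n then min \<tau> (breakpoint t (Suc i)) - min \<tau> (breakpoint t i)
      else if i \<le> Suc (2 * n) then max \<tau> (breakpoint t (Suc (i - Suc n))) - max \<tau> (breakpoint t (i - Suc n))
      else 0)"

lemma breakpoint_splice_weights_lower:
  assumes "0 \<le> \<tau>" "j \<le> Suc n"
  shows "breakpoint (splice_weights n t \<tau>) j = min \<tau> (breakpoint t j)"
  using assms(2)
proof (induction j)
  case (Suc j)
  moreover have "splice_weights n t \<tau> j = min \<tau> (breakpoint t (Suc j)) - min \<tau> (breakpoint t j)"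
    using Suc.prems by (simp add: splice_weights_def)
  ultimately show ?case by (simp add: breakpoint_Suc[of "splice_weights n t \<tau>"])
qed (use assms(1) in simp)

lemma breakpoint_splice_weights_upper:
  assumes t: "t \<in> standard_simplex n" and \<tau>: "\<tau> \<in> {0..1}" and "k \<le> Suc n"
  shows "breakpoint (splice_weights n t \<tau>) (Suc n + k) = max \<tau> (breakpoint t k)"
  using assms(3)
proof (induction k)
  case 0
  then show ?case
    using breakpoint_splice_weights_lower[of \<tau> "Suc n" n t] breakpoint_top[OF t, of "Suc n"] \<tau> by simp
next
  case (Suc k)
  then have "splice_weights n t \<tau> (Suc n + k) = max \<tau> (breakpoint t (Suc k)) - max \<tau> (breakpoint t k)"
    by (simp add: splice_weights_def)
  then show ?case using Suc by (simp add: breakpoint_Suc[of "splice_weights n t \<tau>"])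
qed

lemma splice_weights_in_simplex:
  assumes t: "t \<in> standard_simplex n" and \<tau>: "\<tau> \<in> {0..1}"
  shows "splice_weights n t \<tau> \<in> standard_simplex (Suc (2 * n))"
proof (rule standard_simplexI)
  show "0 \<le> splice_weights n t \<tau> i" for i
    using breakpoint_mono[OF t, of i "Suc i"] breakpoint_mono[OF t, of "i - Suc n" "Suc (i - Suc n)"]
    by (auto simp: splice_weights_def)
  have "breakpoint (splice_weights n t \<tau>) (Suc n + Suc n) = 1"
    using breakpoint_splice_weights_upper[OF assms, of "Suc n"] breakpoint_top[OF t, of "Suc n"] \<tau> by simp
  then show "breakpoint (splice_weights n t \<tau>) (Suc (Suc (2 * n))) = 1"
    by (simp add: mult_2)
qed (simp add: splice_weights_def)

lemma splice_step_fun: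
  assumes t: "t \<in> standard_simplex n" and \<tau>: "\<tau> \<in> {0..1}"
  shows "splice \<tau> (step_fun v t) (step_fun w t) = step_fun (splice_vertices n v w) (splice_weights n t \<tau>)"
proof -
  have "(if u < \<tau> then v (step_index t u) else w (step_index t u))
      = splice_vertices n v w (step_index (splice_weights n t \<tau>) u)" if u: "u \<in> {0..<1}" for u
  proof -
    define j where "j = step_index t u"
    have j: "j \<le> n" "breakpoint t j \<le> u" "u < breakpoint t (Suc j)"
      using step_index_le[OF t u] step_index_eq_iff[OF t u, of j] by (auto simp: j_def)
    note eq = step_index_eq_iff[OF splice_weights_in_simplex[OF assms] u]
    show ?thesis
    proof (cases "u < \<tau>")
      case True
      have "step_index (splice_weights n t \<tau>) u = j"
        unfolding eq using j True \<tau> by (simp add: breakpoint_splice_weights_lower min_def)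
      then show ?thesis using True j by (simp add: splice_vertices_def j_def)
    next
      case False
      have "breakpoint (splice_weights n t \<tau>) (Suc n + j) = max \<tau> (breakpoint t j)"
        "breakpoint (splice_weights n t \<tau>) (Suc (Suc n + j)) = max \<tau> (breakpoint t (Suc j))"
        using breakpoint_splice_weights_upper[OF assms, of j] j
          breakpoint_splice_weights_upper[OF assms, of "Suc j"] by simp_all
      then have "step_index (splice_weights n t \<tau>) u = Suc n + j"
        unfolding eq using j False by (simp only:) (simp add: max_def)
      then show ?thesis using False j by (simp add: splice_vertices_def j_def)
    qed
  qed
  then show ?thesis unfolding splice_def step_fun_def
    by (intro restrict_ext) (simp only: restrict_apply if_True)
qed

lemma splice_vertices_carrier:
  assumes "v \<in> {..n} \<rightarrow> carrier G" "w \<in> {..n} \<rightarrow> carrier G"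
  shows "splice_vertices n v w \<in> {..Suc (2 * n)} \<rightarrow> carrier G"
proof
  fix i assume "i \<in> {..Suc (2 * n)}"
  then have "i \<le> n \<or> i - Suc n \<in> {..n}" by auto
  then show "splice_vertices n v w i \<in> carrier G"
    using assms by (auto simp: splice_vertices_def)
qed

lemma continuous_map_splice_weights:
  "continuous_map (prod_topology (simplex_space n) (top_of_set {0..1})) (simplex_space (Suc (2 * n)))
     (\<lambda>(t, \<tau>). splice_weights n t \<tau>)"
proof -
  let ?P = "prod_topology (simplex_space n) (top_of_set {0..1::real})"
  have b: "continuous_map ?P euclideanreal (\<lambda>x. breakpoint (fst x) j)" for j
    using continuous_map_compose[OF continuous_map_fst continuous_map_breakpoint] by (simp add: comp_def)
  have s: "continuous_map ?P euclideanreal snd"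
    using continuous_map_snd by (rule continuous_map_into_fulltopology)
  have "continuous_map ?P euclideanreal (\<lambda>x. splice_weights n (fst x) (snd x) i)" for i
  proof -
    consider "i \<le> n" | "\<not> i \<le> n" "i \<le> Suc (2 * n)" | "\<not> i \<le> n" "\<not> i \<le> Suc (2 * n)" by blast
    then show ?thesis
      by cases (auto simp: splice_weights_def intro!: continuous_map_diff continuous_map_real_min
          continuous_map_real_max b s)
  qed
  then have "continuous_map ?P (powertop_real UNIV) (\<lambda>x. splice_weights n (fst x) (snd x))"
    by (simp add: continuous_map_componentwise_UNIV)
  then show ?thesis
    by (auto simp: continuous_map_in_subtopology case_prod_unfold splice_weights_in_simplex)
qed

context split_projection
begin

context
  fixes U \<gamma>
  assumes U: "openin (classifying_space G) U" and \<gamma>: "bundle_iso U \<gamma>"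
begin

text \<open>
  By equivariance of \<open>\<gamma>\<close> the contraction commutes with translations, and so it descends to a homotopy
  from \<open>B\<rho>\<close> to the inclusion of \<open>U\<close>.  It is a homotopy over \<open>BQ\<close>, since \<open>p (\<gamma> f) = \<one>\<close> means that both
  pieces have the same image under \<open>p\<close>.
\<close>

definition contraction :: "(real \<Rightarrow> 'g) \<Rightarrow> real \<Rightarrow> real \<Rightarrow> 'g" where
  "contraction f \<tau> = splice \<tau> f (translate G (\<gamma> f) (map_step \<rho> f))"

definition contraction_section :: "'g cell_point set \<Rightarrow> real \<Rightarrow> 'g cell_point set" where
  "contraction_section x = (\<lambda>\<tau>\<in>{0..1}. realize G (contraction (SOME f. f \<in> step_functions G \<and> realize G f = x) \<tau>))"

lemma gamma_carrier: "f \<in> step_functions G \<Longrightarrow> realize G f \<in> U \<Longrightarrow> \<gamma> f \<in> carrier G"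
  using \<gamma> unfolding bundle_iso_def by blast

lemma gamma_p: "f \<in> step_functions G \<Longrightarrow> realize G f \<in> U \<Longrightarrow> p (\<gamma> f) = \<one>\<^bsub>Q\<^esub>"
  using \<gamma> unfolding bundle_iso_def by blast

lemma gamma_translate:
  "f \<in> step_functions G \<Longrightarrow> realize G f \<in> U \<Longrightarrow> g \<in> carrier G \<Longrightarrow>
    \<gamma> (translate G g f) = g \<otimes>\<^bsub>G\<^esub> \<gamma> f \<otimes>\<^bsub>G\<^esub> inv\<^bsub>G\<^esub> (\<rho> g)"
  using \<gamma> unfolding bundle_iso_def by blast

lemma contraction_step_fun:
  assumes v: "v \<in> {..n} \<rightarrow> carrier G" and t: "t \<in> standard_simplex n" and \<tau>: "\<tau> \<in> {0..1}"
  shows "contraction (step_fun v t) \<tau> =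
    step_fun (splice_vertices n v (\<lambda>i. \<gamma> (step_fun v t) \<otimes>\<^bsub>G\<^esub> \<rho> (v i))) (splice_weights n t \<tau>)"
  unfolding contraction_def map_step_step_fun translate_step_fun by (simp add: splice_step_fun[OF t \<tau>])

lemma spliced_vertices_carrier:
  assumes v: "v \<in> {..n} \<rightarrow> carrier G" and g: "g \<in> carrier G"
  shows "splice_vertices n v (\<lambda>i. g \<otimes>\<^bsub>G\<^esub> \<rho> (v i)) \<in> {..Suc (2 * n)} \<rightarrow> carrier G"
proof (rule splice_vertices_carrier[OF v])
  show "(\<lambda>i. g \<otimes>\<^bsub>G\<^esub> \<rho> (v i)) \<in> {..n} \<rightarrow> carrier G"
  proof
    fix i assume "i \<in> {..n}"
    with v have "v i \<in> carrier G" by (rule funcset_mem)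
    with \<rho>_carrier have "\<rho> (v i) \<in> carrier G" by (rule funcset_mem)
    with g show "g \<otimes>\<^bsub>G\<^esub> \<rho> (v i) \<in> carrier G" by simp
  qed
qed

lemma contraction_in_step_functions:
  assumes f: "f \<in> step_functions G" "realize G f \<in> U" and \<tau>: "\<tau> \<in> {0..1}"
  shows "contraction f \<tau> \<in> step_functions G"
  using f(1)
proof (rule step_functionsE)
  fix n v t assume v: "v \<in> {..n} \<rightarrow> carrier G" "t \<in> standard_simplex n" and feq: "f = step_fun v t"
  show ?thesis
    unfolding feq contraction_step_fun[OF v \<tau>]
    using f by (intro step_functionsI[OF spliced_vertices_carrier[OF v(1)] splice_weights_in_simplex[OF v(2) \<tau>]]
        gamma_carrier) (simp_all add: feq)
qed

lemma contraction_translate: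
  assumes f: "f \<in> step_functions G" "realize G f \<in> U" and g: "g \<in> carrier G"
  shows "contraction (translate G g f) \<tau> = translate G g (contraction f \<tau>)"
proof -
  have "\<rho> g \<in> carrier G" "\<gamma> f \<in> carrier G" "map_step \<rho> f \<in> step_functions G"
    using \<rho>_carrier g gamma_carrier[OF f] map_step_in_step_functions[OF \<rho>_carrier f(1)] by auto
  then have "translate G (\<gamma> (translate G g f)) (map_step \<rho> (translate G g f))
      = translate G g (translate G (\<gamma> f) (map_step \<rho> f))"
    using g by (simp add: gamma_translate[OF f g] map_step_translate[OF \<rho>_hom f(1) g] G.translate_translate G.m_assoc)
  then show ?thesis
    unfolding contraction_def by (auto simp: splice_def translate_def)
qed

lemma contraction_section_realize:
  assumes f: "f \<in> step_functions G" "realize G f \<in> U"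
  shows "contraction_section (realize G f) = (\<lambda>\<tau>\<in>{0..1}. realize G (contraction f \<tau>))"
proof -
  define h where "h = (SOME h. h \<in> step_functions G \<and> realize G h = realize G f)"
  have h: "h \<in> step_functions G \<and> realize G h = realize G f"
    unfolding h_def by (rule someI[of _ f]) (use f in simp)
  then obtain g where g: "g \<in> carrier G" "h = translate G g f" using G.realize_eq_iff[OF f(1), of h] by auto
  show ?thesis
    unfolding contraction_section_def h_def[symmetric]
    by (rule restrict_ext)
      (use g f in \<open>simp add: contraction_translate G.realize_translate contraction_in_step_functions\<close>)
qed

lemma contraction_section_end:
  assumes "y \<in> U" shows "contraction_section y 1 = y"
proof -
  have "y \<in> points G" using openin_subset[OF U] assms by auto
  then obtain f where f: "f \<in> step_functions G" "y = realize G f" by (rule G.realize_onto)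
  have "contraction f 1 = f"
    using f assms by (intro step_function_eqI[of _ G _ G] contraction_in_step_functions)
      (auto simp: contraction_def splice_def)
  then show ?thesis using f assms by (simp add: contraction_section_realize)
qed

lemma contraction_section_fibrewise:
  assumes "y \<in> U" "\<tau> \<in> {0..1}"
  shows "classifying_map Q p (contraction_section y \<tau>) = classifying_map Q p y"
    and "contraction_section y 0 = classifying_map G s (classifying_map Q p y)"
proof -
  have "y \<in> points G" using openin_subset[OF U] assms by auto
  then obtain f where f: "f \<in> step_functions G" "y = realize G f" by (rule G.realize_onto)
  have fU: "realize G f \<in> U" using f assms by simp
  have \<rho>s: "map_step \<rho> f \<in> step_functions G" by (rule map_step_in_step_functions[OF \<rho>_carrier f(1)])
  have c: "contraction f \<tau>' \<in> step_functions G" if "\<tau>' \<in> {0..1}" for \<tau>'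
    using contraction_in_step_functions[OF f(1) fU that] .
  have "map_step p (contraction f \<tau>) = map_step p f"
  proof (rule step_function_eqI)
    show "map_step p (contraction f \<tau>) \<in> step_functions Q" "map_step p f \<in> step_functions Q"
      using c[OF assms(2)] f(1) by (auto intro: map_step_in_step_functions[OF p_carrier])
    fix u :: real assume u: "u \<in> {0..<1}"
    have fu: "f u \<in> carrier G" "\<rho> (f u) \<in> carrier G"
      using step_function_carrier[OF f(1) u] \<rho>_carrier by auto
    have "p (\<gamma> f \<otimes>\<^bsub>G\<^esub> \<rho> (f u)) = p (f u)"
      using gamma_p[OF f(1) fU] gamma_carrier[OF f(1) fU] fu hom_in_carrier[OF p fu(1)]
      by (simp add: hom_mult[OF p] p_\<rho>)
    then show "map_step p (contraction f \<tau>) u = map_step p f u"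
      using u by (simp add: map_step_def contraction_def splice_def translate_def)
  qed
  then show "classifying_map Q p (contraction_section y \<tau>) = classifying_map Q p y"
    using assms(2) f fU c by (simp add: contraction_section_realize
        classifying_map_realize[OF G.group_axioms Q.group_axioms p])
  have "contraction f 0 = translate G (\<gamma> f) (map_step \<rho> f)"
    using c[of 0] \<rho>s gamma_carrier[OF f(1) fU]
    by (intro step_function_eqI[of _ G _ G] G.translate_in_step_functions) (auto simp: contraction_def splice_def)
  then show "contraction_section y 0 = classifying_map G s (classifying_map Q p y)"
    using f fU gamma_carrier[OF f(1) fU] \<rho>s
    by (simp add: contraction_section_realize G.realize_translate classifying_map_s_p)
qed

text \<open>
  On a simplex \<open>\<gamma>\<close> is locally constant, and where it is constant the contraction is the composition
  of continuous barycentric coordinates with one characteristic map.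
\<close>

lemma contraction_section_locally_continuous:
  assumes v: "v \<in> {..n} \<rightarrow> carrier G" and t0: "t0 \<in> standard_simplex n" and t0U: "realize G (step_fun v t0) \<in> U"
  obtains T \<Psi> where "openin (simplex_space n) T" "t0 \<in> T"
    "\<And>t. t \<in> T \<Longrightarrow> t \<in> standard_simplex n \<and> realize G (step_fun v t) \<in> U"
    "continuous_map (prod_topology (simplex_space n) (top_of_set {0..1})) (classifying_space G) \<Psi>"
    "\<And>t \<tau>. t \<in> T \<Longrightarrow> \<tau> \<in> {0..1} \<Longrightarrow> contraction_section (realize G (step_fun v t)) \<tau> = \<Psi> (t, \<tau>)"
proof -
  define f0 where "f0 = step_fun v t0"
  have f: "step_fun v t \<in> step_functions G" if "t \<in> standard_simplex n" for t
    using v that by (rule step_functionsI)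
  obtain N where N: "openin (classifying_space G) N" "realize G f0 \<in> N" "N \<subseteq> U"
    "\<And>h. h\<in>step_functions G \<Longrightarrow> realize G h \<in> N \<Longrightarrow> step_dist h f0 < 1/4 \<Longrightarrow> \<gamma> h = \<gamma> f0"
    using \<gamma> f[OF t0] t0U unfolding bundle_iso_def f0_def by meson
  \<comment> \<open>An upper bound for the distance to \<open>f0\<close> that is visibly continuous.\<close>
  define F where "F t = (\<Sum>j\<le>n. \<bar>breakpoint t (Suc j) - breakpoint t0 (Suc j)\<bar>)" for t
  have "continuous_map (simplex_space n) euclideanreal F"
    unfolding F_def
    by (intro continuous_map_sum continuous_map_real_abs continuous_map_diff continuous_map_breakpoint) auto
  then have "openin (simplex_space n) {t \<in> topspace (simplex_space n). F t \<in> {..<1/4}}"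
    by (rule openin_continuous_map_preimage) auto
  moreover have "openin (simplex_space n) {t \<in> standard_simplex n. realize G (step_fun v t) \<in> N}"
    using N(1) v unfolding G.openin_classifying_space by blast
  ultimately have T: "openin (simplex_space n) ({t \<in> topspace (simplex_space n). F t \<in> {..<1/4}} \<inter>
      {t \<in> standard_simplex n. realize G (step_fun v t) \<in> N})" (is "openin _ ?T") by (rule openin_Int)
  define w where "w = splice_vertices n v (\<lambda>i. \<gamma> f0 \<otimes>\<^bsub>G\<^esub> \<rho> (v i))"
  have w: "w \<in> {..Suc (2 * n)} \<rightarrow> carrier G"
    unfolding w_def using gamma_carrier f[OF t0] t0U by (intro spliced_vertices_carrier v) (simp add: f0_def)
  define \<Psi> where "\<Psi> = (\<lambda>r. realize G (step_fun w r)) \<circ> (\<lambda>(t, \<tau>). splice_weights n t \<tau>)"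
  show thesis
  proof (rule that[OF T])
    show "t0 \<in> ?T" using t0 N(2) by (simp add: F_def f0_def)
    show "t \<in> standard_simplex n \<and> realize G (step_fun v t) \<in> U" if "t \<in> ?T" for t
      using that N(3) by auto
    show "continuous_map (prod_topology (simplex_space n) (top_of_set {0..1})) (classifying_space G) \<Psi>"
      unfolding \<Psi>_def
      by (rule continuous_map_compose[OF continuous_map_splice_weights G.continuous_map_characteristic[OF w]])
    fix t \<tau> assume "t \<in> ?T" and \<tau>: "\<tau> \<in> {0..1::real}"
    then have t: "t \<in> standard_simplex n" "F t < 1/4" "realize G (step_fun v t) \<in> N" by auto
    have "step_dist (step_fun v t) f0 < 1/4"
      using step_dist_simplex[OF t(1) t0, of v] t(2) by (simp add: F_def f0_def)
    then have "\<gamma> (step_fun v t) = \<gamma> f0" using N(4) f t by simp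
    then have "contraction (step_fun v t) \<tau> = step_fun w (splice_weights n t \<tau>)"
      by (simp add: contraction_step_fun[OF v t(1) \<tau>] w_def)
    moreover have "realize G (step_fun v t) \<in> U" using t(3) N(3) by blast
    ultimately show "contraction_section (realize G (step_fun v t)) \<tau> = \<Psi> (t, \<tau>)"
      using \<tau> f t by (simp add: contraction_section_realize \<Psi>_def)
  qed
qed

lemma contraction_section_path:
  assumes "y \<in> U"
  shows "continuous_map (top_of_set {0..1}) (classifying_space G) (contraction_section y)"
proof -
  have "y \<in> points G" using openin_subset[OF U] assms by auto
  then obtain n v t where v: "v \<in> {..n} \<rightarrow> carrier G" and t: "t \<in> standard_simplex n" and y: "y = cell_class G n v t"
    by (rule G.pointsE)
  have y: "y = realize G (step_fun v t)" using y G.realize_step_fun[OF v t] by simp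
  obtain T \<Psi> where T: "t \<in> T"
    "continuous_map (prod_topology (simplex_space n) (top_of_set {0..1})) (classifying_space G) \<Psi>"
    "\<And>t \<tau>. t \<in> T \<Longrightarrow> \<tau> \<in> {0..1} \<Longrightarrow> contraction_section (realize G (step_fun v t)) \<tau> = \<Psi> (t, \<tau>)"
    using contraction_section_locally_continuous[OF v t] assms y by metis
  have "continuous_map (top_of_set {0..1}) (prod_topology (simplex_space n) (top_of_set {0..1})) (\<lambda>\<tau>. (t, \<tau>))"
    using t by (simp add: continuous_map_pairwise comp_def)
  from continuous_map_compose[OF this T(2)]
  show ?thesis by (rule continuous_map_eq) (use T(1,3) y in simp)
qed

text \<open>
  Openness of the preimage of a subbasic set of paths is tested on each simplex separately, where the
  tube lemma applies.  In this way the product of the weak topology with the unit interval never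
  has to be described.
\<close>

lemma bundle_iso_imp_section: "has_section U"
proof -
  let ?B = "classifying_space G" and ?I = "top_of_set {0..1::real}"
  have ext: "contraction_section y \<in> extensional (topspace ?I)" for y
    by (simp add: contraction_section_def)
  have open_pre: "openin ?B {y \<in> U. contraction_section y ` C \<subseteq> W}"
    if C: "compactin ?I C" and W: "openin ?B W" for C W
    unfolding G.openin_classifying_space
  proof (intro conjI allI impI)
    show "{y \<in> U. contraction_section y ` C \<subseteq> W} \<subseteq> points G" using openin_subset[OF U] by auto
    fix n :: nat and v assume v: "v \<in> {..n} \<rightarrow> carrier G"
    let ?V = "{t \<in> standard_simplex n. realize G (step_fun v t) \<in> {y \<in> U. contraction_section y ` C \<subseteq> W}}"
    have C01: "C \<subseteq> {0..1}" using compactin_subset_topspace[OF C] by simp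
    show "openin (simplex_space n) ?V"
    proof (subst openin_subopen, intro ballI)
      fix t0 assume t0: "t0 \<in> ?V"
      obtain T \<Psi> where T: "openin (simplex_space n) T" "t0 \<in> T"
        "\<And>t. t \<in> T \<Longrightarrow> t \<in> standard_simplex n \<and> realize G (step_fun v t) \<in> U"
        "continuous_map (prod_topology (simplex_space n) ?I) ?B \<Psi>"
        "\<And>t \<tau>. t \<in> T \<Longrightarrow> \<tau> \<in> {0..1} \<Longrightarrow> contraction_section (realize G (step_fun v t)) \<tau> = \<Psi> (t, \<tau>)"
        using contraction_section_locally_continuous[OF v, of t0] t0 by blast
      have o: "openin (prod_topology (simplex_space n) ?I) {z \<in> topspace (prod_topology (simplex_space n) ?I). \<Psi> z \<in> W}"
        using T(4) W by (rule openin_continuous_map_preimage)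
      have sub: "{t0} \<times> C \<subseteq> {z \<in> topspace (prod_topology (simplex_space n) ?I). \<Psi> z \<in> W}"
      proof -
        have "\<Psi> (t0, \<tau>) \<in> W" if "\<tau> \<in> C" for \<tau>
        proof -
          have "contraction_section (realize G (step_fun v t0)) \<tau> \<in> W" using t0 that by blast
          then show ?thesis using T(5)[OF T(2), of \<tau>] that C01 by auto
        qed
        then show ?thesis using t0 C01 by auto
      qed
      have "t0 \<in> topspace (simplex_space n)" using t0 by simp
      from tube_lemma_right[OF o C this sub] obtain T' V' where T': "openin (simplex_space n) T'" "t0 \<in> T'" "C \<subseteq> V'"
        "T' \<times> V' \<subseteq> {z \<in> topspace (prod_topology (simplex_space n) ?I). \<Psi> z \<in> W}"
        by blast
      have "T \<inter> T' \<subseteq> ?V"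
      proof
        fix t assume t: "t \<in> T \<inter> T'"
        have "contraction_section (realize G (step_fun v t)) \<tau> \<in> W" if "\<tau> \<in> C" for \<tau>
        proof -
          have "(t, \<tau>) \<in> T' \<times> V'" using t that T'(3) by auto
          then show ?thesis using T'(4) T(5)[of t \<tau>] t that C01 by auto
        qed
        then show "t \<in> ?V" using T(3)[of t] t by auto
      qed
      then show "\<exists>T. openin (simplex_space n) T \<and> t0 \<in> T \<and> T \<subseteq> ?V"
        using openin_Int[OF T(1) T'(1)] T(2) T'(2) by blast
    qed
  qed
  have cont: "continuous_map (subtopology ?B U) (compact_open_topology ?I ?B) contraction_section"
    unfolding compact_open_topology_def
  proof (rule continuous_on_generated_topo)
    fix O' assume "O' \<in> {{f \<in> extensional (topspace ?I). continuous_map ?I ?B f \<and> f ` C \<subseteq> W} | C W.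
        compactin ?I C \<and> openin ?B W}"
    then obtain C W where O': "O' = {f \<in> extensional (topspace ?I). continuous_map ?I ?B f \<and> f ` C \<subseteq> W}"
      "compactin ?I C" "openin ?B W" by blast
    have "contraction_section -` O' \<inter> topspace (subtopology ?B U) = {y \<in> U. contraction_section y ` C \<subseteq> W}"
      using ext contraction_section_path openin_subset[OF U] unfolding O'(1) by auto
    then show "openin (subtopology ?B U) (contraction_section -` O' \<inter> topspace (subtopology ?B U))"
      using open_pre[OF O'(2,3)] by (simp add: openin_open_subtopology[OF U])
  next
    show "contraction_section ` topspace (subtopology ?B U) \<subseteq>
        \<Union> {{f \<in> extensional (topspace ?I). continuous_map ?I ?B f \<and> f ` C \<subseteq> W} | C W.
          compactin ?I C \<and> openin ?B W}"
    proof
      fix \<alpha> assume "\<alpha> \<in> contraction_section ` topspace (subtopology ?B U)"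
      \<comment> \<open>The subbasic set of the empty compact set and the empty open set contains all paths.\<close>
      then have "\<alpha> \<in> {f \<in> extensional (topspace ?I). continuous_map ?I ?B f \<and> f ` {} \<subseteq> {}}"
        using ext contraction_section_path by auto
      moreover have "compactin ?I {}" "openin ?B {}" by simp_all
      ultimately show "\<alpha> \<in> \<Union> {{f \<in> extensional (topspace ?I). continuous_map ?I ?B f \<and> f ` C \<subseteq> W} | C W.
          compactin ?I C \<and> openin ?B W}" by blast
    qed
  qed
  have mem: "contraction_section y \<in> {\<alpha>. (\<forall>u\<in>{0..1}. classifying_map Q p (\<alpha> u) = classifying_map Q p (\<alpha> 0)) \<and>
      \<alpha> 0 = classifying_map G s (classifying_map Q p (\<alpha> 0))}" if "y \<in> U" for y
  proof (intro CollectI conjI ballI)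
    have q0: "classifying_map Q p (contraction_section y 0) = classifying_map Q p y"
      by (rule contraction_section_fibrewise(1)[OF that]) simp
    show "classifying_map Q p (contraction_section y u) = classifying_map Q p (contraction_section y 0)"
      if "u \<in> {0..1}" for u
      unfolding q0 by (rule contraction_section_fibrewise(1)[OF \<open>y \<in> U\<close> that])
    show "contraction_section y 0 = classifying_map G s (classifying_map Q p (contraction_section y 0))"
      unfolding q0 by (rule contraction_section_fibrewise(2)[OF that, of 0]) simp
  qed
  have "continuous_map (subtopology ?B U) path_space contraction_section"
    unfolding fibrewise_path_space_def
  proof (rule continuous_map_into_subtopology[OF cont funcsetI])
    fix y assume "y \<in> topspace (subtopology ?B U)"
    then have "y \<in> U" by simp
    then show "contraction_section y \<in> {\<alpha>. (\<forall>u\<in>{0..1}. classifying_map Q p (\<alpha> u) = classifying_map Q p (\<alpha> 0)) \<and>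
      \<alpha> 0 = classifying_map G s (classifying_map Q p (\<alpha> 0))}" by (rule mem)
  qed
  then show ?thesis
    unfolding has_section_def using contraction_section_end by (intro exI[of _ contraction_section] conjI ballI)
qed

end

lemma has_section_iff_bundle_iso:
  assumes U: "openin (classifying_space G) U"
  shows "has_section U \<longleftrightarrow> (\<exists>\<gamma>. bundle_iso U \<gamma>)"
proof
  assume "has_section U"
  then obtain \<sigma> where \<sigma>: "continuous_map (subtopology (classifying_space G) U) path_space \<sigma>" "\<forall>y\<in>U. \<sigma> y 1 = y"
    unfolding has_section_def by (elim exE conjE)
  show "\<exists>\<gamma>. bundle_iso U \<gamma>"
    by (rule section_imp_bundle_iso[OF U \<sigma>(1)]) (rule bspec[OF \<sigma>(2)])
next
  assume "\<exists>\<gamma>. bundle_iso U \<gamma>"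
  then show "has_section U" using bundle_iso_imp_section[OF U] by (elim exE)
qed

definition coverable :: "nat \<Rightarrow> bool" where
  "coverable n \<longleftrightarrow> (\<exists>U. (\<Union>i\<le>n. U i) = points G \<and>
     (\<forall>i\<le>n. openin (classifying_space G) (U i) \<and> (\<exists>\<gamma>. bundle_iso (U i) \<gamma>)))"

lemma parametrized_cat_eq_Inf:
  "parametrized_cat (classifying_space G) (classifying_map Q p) (classifying_map G s) = Inf {enat n | n. coverable n}"
proof -
  define P where "P U \<sigma> \<longleftrightarrow> openin (classifying_space G) U \<and>
        continuous_map (subtopology (classifying_space G) U) path_space \<sigma> \<and>
        (\<forall>y\<in>U. \<sigma> y 1 = y)" for U \<sigma>
  have P: "(\<exists>\<sigma>. P U \<sigma>) \<longleftrightarrow> openin (classifying_space G) U \<and> (\<exists>\<gamma>. bundle_iso U \<gamma>)" for U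
    unfolding P_def using has_section_iff_bundle_iso[of U] unfolding has_section_def by blast
  have choice: "(\<exists>\<sigma>. \<forall>i\<le>n. P (U i) (\<sigma> i)) \<longleftrightarrow> (\<forall>i\<le>n. \<exists>\<sigma>. P (U i) \<sigma>)" for n and U :: "nat \<Rightarrow> _"
    by metis
  have "(\<exists>U \<sigma>. (\<Union>i\<le>n. U i) = topspace (classifying_space G) \<and> (\<forall>i\<le>n. P (U i) (\<sigma> i))) \<longleftrightarrow> coverable n" for n
    unfolding coverable_def by (simp add: choice P)
  then show ?thesis
    unfolding parametrized_cat_def secat_def P_def by simp
qed

end

section \<open>Comparison of parametrized categories\<close>

text \<open>
  Isomorphisms of bundles can be transported along a homomorphism \<open>\<phi>\<close> and a map \<open>\<Psi>\<close> in the opposite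
  direction, which need not be a homomorphism but has to respect the twisted conjugations
  \<open>z \<mapsto> g z \<rho>(g)\<inverse>\<close>: on the preimage of \<open>U\<close>, the new isomorphism is \<open>f \<mapsto> \<Psi> (\<gamma> (\<phi> \<circ> f))\<close>.
\<close>

lemma parametrized_cat_le:
  fixes G1 :: "'g monoid" and Q1 :: "'q monoid" and G2 :: "'h monoid" and Q2 :: "'r monoid"
  assumes "split_projection G1 Q1 p1 s1" "split_projection G2 Q2 p2 s2"
    and \<phi>: "\<phi> \<in> hom G1 G2"
    and \<Psi>: "\<And>z. z \<in> carrier G2 \<Longrightarrow> p2 z = \<one>\<^bsub>Q2\<^esub> \<Longrightarrow> \<Psi> z \<in> carrier G1 \<and> p1 (\<Psi> z) = \<one>\<^bsub>Q1\<^esub>"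
    and \<Psi>_equivariant: "\<And>z g. z \<in> carrier G2 \<Longrightarrow> p2 z = \<one>\<^bsub>Q2\<^esub> \<Longrightarrow> g \<in> carrier G1 \<Longrightarrow>
      \<Psi> (\<phi> g \<otimes>\<^bsub>G2\<^esub> z \<otimes>\<^bsub>G2\<^esub> inv\<^bsub>G2\<^esub> (s2 (p2 (\<phi> g)))) = g \<otimes>\<^bsub>G1\<^esub> \<Psi> z \<otimes>\<^bsub>G1\<^esub> inv\<^bsub>G1\<^esub> (s1 (p1 g))"
  shows "parametrized_cat (classifying_space G1) (classifying_map Q1 p1) (classifying_map G1 s1)
    \<le> parametrized_cat (classifying_space G2) (classifying_map Q2 p2) (classifying_map G2 s2)"
proof -
  interpret A: split_projection G1 Q1 p1 s1 by fact
  interpret B: split_projection G2 Q2 p2 s2 by fact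
  note Bphi = continuous_map_classifying_map[OF A.G.group_axioms B.G.group_axioms \<phi>]
  note real = classifying_map_realize[OF A.G.group_axioms B.G.group_axioms \<phi>]
  have c: "\<phi> \<in> carrier G1 \<rightarrow> carrier G2" using \<phi> by (rule hom_in_carrier[THEN funcsetI])
  define pre where "pre U = {x \<in> topspace (classifying_space G1). classifying_map G2 \<phi> x \<in> U}" for U
  have pre_open: "openin (classifying_space G1) (pre U)" if "openin (classifying_space G2) U" for U
    unfolding pre_def using Bphi that by (rule openin_continuous_map_preimage)
  have iso: "A.bundle_iso (pre U) (\<lambda>f. \<Psi> (\<gamma> (map_step \<phi> f)))" if \<gamma>: "B.bundle_iso U \<gamma>" for U \<gamma>
    unfolding A.bundle_iso_def
  proof (intro ballI impI)
    fix f assume f: "f \<in> step_functions G1" "realize G1 f \<in> pre U"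
    define h where "h = map_step \<phi> f"
    have h: "h \<in> step_functions G2" "realize G2 h \<in> U"
      using f map_step_in_step_functions[OF c f(1)] by (auto simp: h_def pre_def real)
    have g1: "\<gamma> h \<in> carrier G2" "p2 (\<gamma> h) = \<one>\<^bsub>Q2\<^esub>"
      and g2: "\<And>g. g\<in>carrier G2 \<Longrightarrow> \<gamma> (translate G2 g h) = g \<otimes>\<^bsub>G2\<^esub> \<gamma> h \<otimes>\<^bsub>G2\<^esub> inv\<^bsub>G2\<^esub> (s2 (p2 g))"
      using \<gamma> h unfolding B.bundle_iso_def B.\<rho>_def by blast+
    obtain N where N: "openin (classifying_space G2) N" "realize G2 h \<in> N" "N \<subseteq> U"
      "\<And>k. k\<in>step_functions G2 \<Longrightarrow> realize G2 k \<in> N \<Longrightarrow> step_dist k h < 1/4 \<Longrightarrow> \<gamma> k = \<gamma> h"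
      using \<gamma> h unfolding B.bundle_iso_def by meson
    have "\<exists>N. openin (classifying_space G1) N \<and> realize G1 f \<in> N \<and> N \<subseteq> pre U \<and>
        (\<forall>h\<in>step_functions G1. realize G1 h \<in> N \<longrightarrow> step_dist h f < 1/4 \<longrightarrow>
           \<Psi> (\<gamma> (map_step \<phi> h)) = \<Psi> (\<gamma> (map_step \<phi> f)))"
    proof (intro exI[of _ "pre N"] conjI ballI impI)
      show "openin (classifying_space G1) (pre N)" by (rule pre_open[OF N(1)])
      show "realize G1 f \<in> pre N" using f N(2) by (simp add: pre_def real h_def)
      show "pre N \<subseteq> pre U" using N(3) by (auto simp: pre_def)
      fix k assume k: "k \<in> step_functions G1" "realize G1 k \<in> pre N" "step_dist k f < 1/4"
      have "step_dist (map_step \<phi> k) h < 1/4"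
        using step_dist_map_step[OF c k(1) f(1)] k(3) by (simp add: h_def)
      then show "\<Psi> (\<gamma> (map_step \<phi> k)) = \<Psi> (\<gamma> (map_step \<phi> f))"
        using N(4)[OF map_step_in_step_functions[OF c k(1)]] k by (simp add: pre_def real h_def)
    qed
    moreover have "\<Psi> (\<gamma> (map_step \<phi> (translate G1 g f))) = g \<otimes>\<^bsub>G1\<^esub> \<Psi> (\<gamma> (map_step \<phi> f)) \<otimes>\<^bsub>G1\<^esub> inv\<^bsub>G1\<^esub> (A.\<rho> g)"
      if "g \<in> carrier G1" for g
      using g2[OF hom_in_carrier[OF \<phi> that]] \<Psi>_equivariant[OF g1 that]
      by (simp add: map_step_translate[OF \<phi> f(1) that] h_def A.\<rho>_def)
    ultimately show "\<Psi> (\<gamma> (map_step \<phi> f)) \<in> carrier G1 \<and> p1 (\<Psi> (\<gamma> (map_step \<phi> f))) = \<one>\<^bsub>Q1\<^esub> \<and>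
       (\<forall>g\<in>carrier G1. \<Psi> (\<gamma> (map_step \<phi> (translate G1 g f))) =
          g \<otimes>\<^bsub>G1\<^esub> \<Psi> (\<gamma> (map_step \<phi> f)) \<otimes>\<^bsub>G1\<^esub> inv\<^bsub>G1\<^esub> (A.\<rho> g)) \<and>
       (\<exists>N. openin (classifying_space G1) N \<and> realize G1 f \<in> N \<and> N \<subseteq> pre U \<and>
        (\<forall>h\<in>step_functions G1. realize G1 h \<in> N \<longrightarrow> step_dist h f < 1/4 \<longrightarrow>
           \<Psi> (\<gamma> (map_step \<phi> h)) = \<Psi> (\<gamma> (map_step \<phi> f))))"
      using \<Psi>[OF g1] by (simp add: h_def)
  qed
  have "A.coverable n" if "B.coverable n" for n
  proof -
    obtain U where "(\<Union>i\<le>n. U i) = points G2 \<and>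
       (\<forall>i\<le>n. openin (classifying_space G2) (U i) \<and> (\<exists>\<gamma>. B.bundle_iso (U i) \<gamma>))"
      using \<open>B.coverable n\<close> unfolding B.coverable_def by (elim exE)
    then have U: "(\<Union>i\<le>n. U i) = points G2"
     "\<And>i. i\<le>n \<Longrightarrow> openin (classifying_space G2) (U i) \<and> (\<exists>\<gamma>. B.bundle_iso (U i) \<gamma>)"
      by simp_all
    have "classifying_map G2 \<phi> x \<in> (\<Union>i\<le>n. U i)" if "x \<in> points G1" for x
    proof -
      have "classifying_map G2 \<phi> x \<in> points G2"
        using continuous_map_image_subset_topspace[OF Bphi] that
        unfolding A.G.topspace_classifying_space B.G.topspace_classifying_space by blast
      then show ?thesis unfolding U(1) .
    qed
    then have "(\<Union>i\<le>n. pre (U i)) = points G1" unfolding pre_def A.G.topspace_classifying_space by blast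
    moreover have "openin (classifying_space G1) (pre (U i)) \<and> (\<exists>\<gamma>. A.bundle_iso (pre (U i)) \<gamma>)"
      if "i \<le> n" for i
    proof -
      have i: "i \<le> n" by fact
      obtain \<gamma> where "B.bundle_iso (U i) \<gamma>" using U(2)[OF i] by (elim conjE exE)
      then have "A.bundle_iso (pre (U i)) (\<lambda>f. \<Psi> (\<gamma> (map_step \<phi> f)))" by (rule iso)
      then show ?thesis using pre_open U(2)[OF i] by (intro conjI exI) simp_all
    qed
    ultimately show ?thesis unfolding A.coverable_def by (intro exI[of _ "\<lambda>i. pre (U i)"]) simp
  qed
  then show ?thesis
    unfolding A.parametrized_cat_eq_Inf B.parametrized_cat_eq_Inf by (intro Inf_superset_mono) blast
qed

text \<open>
  Here \<open>\<Psi>\<close> is the retraction itself: a homomorphism over \<open>Q\<close> that respects the splittings also respects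
  the twisted conjugations.
\<close>

lemma parametrized_cat_retract_le:
  fixes G1 :: "'g monoid" and G2 :: "'h monoid" and Q :: "'q monoid"
  assumes A: "split_projection G1 Q p1 s1" and B: "split_projection G2 Q p2 s2"
    and \<phi>: "\<phi> \<in> hom G1 G2" and \<psi>: "\<psi> \<in> hom G2 G1"
    and retract: "\<And>g. g \<in> carrier G1 \<Longrightarrow> \<psi> (\<phi> g) = g"
    and over: "\<And>g. g \<in> carrier G1 \<Longrightarrow> p2 (\<phi> g) = p1 g" "\<And>z. z \<in> carrier G2 \<Longrightarrow> p1 (\<psi> z) = p2 z"
    and under: "\<And>q. q \<in> carrier Q \<Longrightarrow> \<psi> (s2 q) = s1 q"
  shows "parametrized_cat (classifying_space G1) (classifying_map Q p1) (classifying_map G1 s1)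
    \<le> parametrized_cat (classifying_space G2) (classifying_map Q p2) (classifying_map G2 s2)"
proof -
  interpret A: split_projection G1 Q p1 s1 by fact
  interpret B: split_projection G2 Q p2 s2 by fact
  interpret \<psi>: group_hom G2 G1 \<psi>
    by (intro group_hom.intro group_hom_axioms.intro A.G.group_axioms B.G.group_axioms \<psi>)
  show ?thesis
  proof (rule parametrized_cat_le[OF A B \<phi>])
    fix z assume z: "z \<in> carrier G2" "p2 z = \<one>\<^bsub>Q\<^esub>"
    then show "\<psi> z \<in> carrier G1 \<and> p1 (\<psi> z) = \<one>\<^bsub>Q\<^esub>" using over(2) by simp
    fix g assume g: "g \<in> carrier G1"
    have "\<phi> g \<in> carrier G2" "p1 g \<in> carrier Q" using hom_in_carrier[OF \<phi> g] hom_in_carrier[OF A.p g] .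
    moreover from this(2) have "s2 (p1 g) \<in> carrier G2" by (rule hom_in_carrier[OF B.s])
    ultimately show "\<psi> (\<phi> g \<otimes>\<^bsub>G2\<^esub> z \<otimes>\<^bsub>G2\<^esub> inv\<^bsub>G2\<^esub> (s2 (p2 (\<phi> g)))) = g \<otimes>\<^bsub>G1\<^esub> \<psi> z \<otimes>\<^bsub>G1\<^esub> inv\<^bsub>G1\<^esub> (s1 (p1 g))"
      using z g by (simp add: retract over under)
  qed
qed

text \<open>
  Enlarging the base from \<open>Q\<close> to \<open>L\<close>.  Let \<open>\<rho> = s \<circ> p\<close> and \<open>\<rho>' = s \<circ> t \<circ> r \<circ> p\<close>.  Over \<open>Q\<close> the
  values \<open>z\<close> of a bundle isomorphism lie in the kernel of \<open>r \<circ> p\<close>, and \<open>z \<mapsto> z \<rho>(z)\<inverse>\<close> moves them into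
  the smaller kernel of \<open>p\<close>.  This respects the twisted conjugations because \<open>\<rho>\<close> fixes the image of \<open>\<rho>'\<close>.
  On homotopies it is the step from a path over \<open>BQ\<close> to a path over \<open>BL\<close> with the same end.
\<close>

lemma parametrized_cat_tower_le:
  fixes G :: "'g monoid" and L :: "'l monoid" and Q :: "'q monoid"
  assumes A: "split_projection G L p s" and B: "split_projection G Q (r \<circ> p) (s \<circ> t)"
    and t: "t \<in> hom Q L"
  shows "parametrized_cat (classifying_space G) (classifying_map L p) (classifying_map G s)
    \<le> parametrized_cat (classifying_space G) (classifying_map Q (r \<circ> p)) (classifying_map G (s \<circ> t))"
proof -
  interpret A: split_projection G L p s by fact
  interpret B: split_projection G Q "r \<circ> p" "s \<circ> t" by fact
  interpret \<rho>: group_hom G G A.\<rho>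
    by (intro group_hom.intro group_hom_axioms.intro A.G.group_axioms A.\<rho>_hom)
  interpret p: group_hom G L p
    by (intro group_hom.intro group_hom_axioms.intro A.G.group_axioms A.Q.group_axioms A.p)
  define \<Psi> where "\<Psi> z = z \<otimes>\<^bsub>G\<^esub> inv\<^bsub>G\<^esub> (A.\<rho> z)" for z
  show ?thesis
  proof (rule parametrized_cat_le[OF A B, of "\<lambda>g. g" \<Psi>])
    show "(\<lambda>g. g) \<in> hom G G" by (simp add: hom_def)
    fix z assume z: "z \<in> carrier G"
    then show "\<Psi> z \<in> carrier G \<and> p (\<Psi> z) = \<one>\<^bsub>L\<^esub>" by (simp add: \<Psi>_def A.p_\<rho>)
    fix g assume g: "g \<in> carrier G"
    define w where "w = (s \<circ> t) ((r \<circ> p) g)"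
    have q: "(r \<circ> p) g \<in> carrier Q" using hom_in_carrier[OF B.p g] .
    then have w: "w \<in> carrier G" unfolding w_def by (rule hom_in_carrier[OF B.s])
    have "A.\<rho> w = w"
      using A.split hom_in_carrier[OF t q] by (simp add: A.\<rho>_def w_def)
    then have "A.\<rho> (g \<otimes>\<^bsub>G\<^esub> z \<otimes>\<^bsub>G\<^esub> inv\<^bsub>G\<^esub> w) = A.\<rho> g \<otimes>\<^bsub>G\<^esub> A.\<rho> z \<otimes>\<^bsub>G\<^esub> inv\<^bsub>G\<^esub> w"
      using z g w by simp
    then have "\<Psi> (g \<otimes>\<^bsub>G\<^esub> z \<otimes>\<^bsub>G\<^esub> inv\<^bsub>G\<^esub> w)
        = g \<otimes>\<^bsub>G\<^esub> (z \<otimes>\<^bsub>G\<^esub> (inv\<^bsub>G\<^esub> w \<otimes>\<^bsub>G\<^esub> (w \<otimes>\<^bsub>G\<^esub> (inv\<^bsub>G\<^esub> (A.\<rho> z) \<otimes>\<^bsub>G\<^esub> inv\<^bsub>G\<^esub> (A.\<rho> g)))))"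
      using z g w by (simp add: \<Psi>_def A.G.inv_mult_group A.G.m_assoc)
    also have "inv\<^bsub>G\<^esub> w \<otimes>\<^bsub>G\<^esub> (w \<otimes>\<^bsub>G\<^esub> (inv\<^bsub>G\<^esub> (A.\<rho> z) \<otimes>\<^bsub>G\<^esub> inv\<^bsub>G\<^esub> (A.\<rho> g))) = inv\<^bsub>G\<^esub> (A.\<rho> z) \<otimes>\<^bsub>G\<^esub> inv\<^bsub>G\<^esub> (A.\<rho> g)"
      using z g w by (simp add: A.G.m_assoc[symmetric])
    finally show "\<Psi> (g \<otimes>\<^bsub>G\<^esub> z \<otimes>\<^bsub>G\<^esub> inv\<^bsub>G\<^esub> ((s \<circ> t) ((r \<circ> p) g))) = g \<otimes>\<^bsub>G\<^esub> \<Psi> z \<otimes>\<^bsub>G\<^esub> inv\<^bsub>G\<^esub> (s (p g))"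
      using z g by (simp add: \<Psi>_def w_def A.\<rho>_def[symmetric] A.G.m_assoc)
  qed
qed

section \<open>Semi-direct products and derivations\<close>

lemma semidirect_simps [simp]:
  "carrier (semidirect K G a) = carrier K \<times> carrier G"
  "(k, g) \<otimes>\<^bsub>semidirect K G a\<^esub> (k', g') = (k \<otimes>\<^bsub>K\<^esub> a g k', g \<otimes>\<^bsub>G\<^esub> g')"
  "\<one>\<^bsub>semidirect K G a\<^esub> = (\<one>\<^bsub>K\<^esub>, \<one>\<^bsub>G\<^esub>)"
  by (simp_all add: semidirect_def)

locale automorphism_action = G: group G + K: group K for G :: "'g monoid" and K :: "'k monoid" +
  fixes a :: "'g \<Rightarrow> 'k \<Rightarrow> 'k"
  assumes action: "a \<in> hom G (AutoGroup K)"
begin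

lemma action_auto: "g \<in> carrier G \<Longrightarrow> a g \<in> hom K K \<inter> Bij (carrier K)"
  using hom_in_carrier[OF action, of g] by (simp add: AutoGroup_def auto_def)

lemma action_closed [simp]: "g \<in> carrier G \<Longrightarrow> k \<in> carrier K \<Longrightarrow> a g k \<in> carrier K"
  using action_auto by (auto dest: hom_in_carrier)

lemma action_mult: "g \<in> carrier G \<Longrightarrow> k \<in> carrier K \<Longrightarrow> k' \<in> carrier K \<Longrightarrow>
    a g (k \<otimes>\<^bsub>K\<^esub> k') = a g k \<otimes>\<^bsub>K\<^esub> a g k'"
  using action_auto by (auto dest: hom_mult)

lemma action_comp:
  assumes "g \<in> carrier G" "h \<in> carrier G" "k \<in> carrier K"
  shows "a (g \<otimes>\<^bsub>G\<^esub> h) k = a g (a h k)"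
proof -
  have "a (g \<otimes>\<^bsub>G\<^esub> h) = a g \<otimes>\<^bsub>AutoGroup K\<^esub> a h" using hom_mult[OF action assms(1,2)] .
  then show ?thesis
    using assms action_auto by (simp add: AutoGroup_def BijGroup_def compose_def)
qed

lemma action_one [simp]:
  assumes "k \<in> carrier K" shows "a \<one>\<^bsub>G\<^esub> k = k"
proof -
  interpret group_hom G "AutoGroup K" a
    by (intro group_hom.intro group_hom_axioms.intro G.group_axioms K.AutoGroup action)
  show ?thesis using hom_one assms by (simp add: AutoGroup_def BijGroup_def)
qed

lemma action_unit [simp]:
  assumes "g \<in> carrier G" shows "a g \<one>\<^bsub>K\<^esub> = \<one>\<^bsub>K\<^esub>"
  using action_mult[OF assms K.one_closed K.one_closed] assms by (simp add: K.l_cancel_one')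

lemma group_semidirect: "group (semidirect K G a)"
proof (rule groupI)
  show "x \<otimes>\<^bsub>semidirect K G a\<^esub> y \<otimes>\<^bsub>semidirect K G a\<^esub> z = x \<otimes>\<^bsub>semidirect K G a\<^esub> (y \<otimes>\<^bsub>semidirect K G a\<^esub> z)"
    if "x \<in> carrier (semidirect K G a)" "y \<in> carrier (semidirect K G a)" "z \<in> carrier (semidirect K G a)" for x y z
    using that by (cases x; cases y; cases z) (simp add: action_mult action_comp K.m_assoc G.m_assoc)
  show "\<exists>y\<in>carrier (semidirect K G a). y \<otimes>\<^bsub>semidirect K G a\<^esub> x = \<one>\<^bsub>semidirect K G a\<^esub>"
    if "x \<in> carrier (semidirect K G a)" for x
  proof (cases x)
    case (Pair k g)
    with that show ?thesis
      by (intro bexI[of _ "(a (inv\<^bsub>G\<^esub> g) (inv\<^bsub>K\<^esub> k), inv\<^bsub>G\<^esub> g)"]) (auto simp: action_mult[symmetric])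
  qed
qed (auto simp: action_closed)

lemma split_projection_semidirect:
  assumes "derivation G K a d"
  shows "split_projection (semidirect K G a) G snd (splitting d)"
proof (intro split_projection.intro discrete_group.intro split_projection_axioms.intro)
  show "group (semidirect K G a)" by (rule group_semidirect)
  show "group G" by (rule G.group_axioms)
  show "snd \<in> hom (semidirect K G a) G" by (auto simp: hom_def)
  show "splitting d \<in> hom G (semidirect K G a)"
    using assms by (auto simp: hom_def splitting_def derivation_def)
qed (simp add: splitting_def)

end

theorem theorem3p22:
  fixes G :: "'g monoid" and H :: "'h monoid" and K :: "'k monoid"
    and a :: "'g \<Rightarrow> 'h \<Rightarrow> 'h" and b :: "'h \<times> 'g \<Rightarrow> 'k \<Rightarrow> 'k"
    and d :: "'g \<Rightarrow> 'h" and d' :: "'h \<times> 'g \<Rightarrow> 'k"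
  assumes "group G" and "group H" and "group K"
    and "a \<in> hom G (AutoGroup H)"
    and "derivation G H a d"
    and "b \<in> hom (semidirect H G a) (AutoGroup K)"
    and "derivation (semidirect H G a) K b d'"
  shows "tc G (semidirect K H (restrict_action_left G b)) (conj_action H K a b)
             (derivation_star d' d)
           \<ge> max (tc G H a d) (tc (semidirect H G a) K b d')"
proof -
  interpret HG: automorphism_action G H a
    using assms by (intro automorphism_action.intro automorphism_action_axioms.intro)
  define L where "L = semidirect H G a"
  interpret KL: automorphism_action L K b
    using assms HG.group_semidirect unfolding L_def
    by (intro automorphism_action.intro automorphism_action_axioms.intro)
  define X where "X = semidirect K L b"
  define X' where "X' = semidirect (semidirect K H (restrict_action_left G b)) G (conj_action H K a b)"
  define \<phi> :: "'k \<times> 'h \<times> 'g \<Rightarrow> ('k \<times> 'h) \<times> 'g" where "\<phi> = (\<lambda>(k, h, g). ((k, h), g))"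
  define \<psi> :: "('k \<times> 'h) \<times> 'g \<Rightarrow> 'k \<times> 'h \<times> 'g" where "\<psi> = (\<lambda>((k, h), g). (k, h, g))"
  have L: "carrier L = carrier H \<times> carrier G" by (simp add: L_def)
  have X: "carrier X = carrier K \<times> carrier H \<times> carrier G" by (simp add: X_def L)
  have X': "carrier X' = (carrier K \<times> carrier H) \<times> carrier G" by (simp add: X'_def)
  interpret A: split_projection L G snd "splitting d"
    unfolding L_def by (rule HG.split_projection_semidirect[OF assms(5)])
  interpret B: split_projection X L snd "splitting d'"
    unfolding X_def by (rule KL.split_projection_semidirect) (use assms(7) in \<open>simp add: L_def\<close>)
  have \<phi>_mult: "\<phi> (x \<otimes>\<^bsub>X\<^esub> y) = \<phi> x \<otimes>\<^bsub>X'\<^esub> \<phi> y" if "x \<in> carrier X" "y \<in> carrier X" for x y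
  proof -
    obtain k h g k' h' g' where xy: "x = (k, h, g)" "y = (k', h', g')" by (metis prod.collapse)
    have c: "k \<in> carrier K" "h \<in> carrier H" "g \<in> carrier G" "k' \<in> carrier K" "h' \<in> carrier H" "g' \<in> carrier G"
      using that by (auto simp: xy X)
    have "(h, \<one>\<^bsub>G\<^esub>) \<otimes>\<^bsub>L\<^esub> (\<one>\<^bsub>H\<^esub>, g) = (h, g)" using c by (simp add: L_def)
    then have "b (h, g) k' = b (h, \<one>\<^bsub>G\<^esub>) (b (\<one>\<^bsub>H\<^esub>, g) k')"
      using KL.action_comp[of "(h, \<one>\<^bsub>G\<^esub>)" "(\<one>\<^bsub>H\<^esub>, g)" k'] c by (simp add: L)
    then show ?thesis
      using c by (simp add: xy \<phi>_def X_def X'_def L_def conj_action_def restrict_action_left_def)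
  qed
  have \<phi>_hom: "\<phi> \<in> hom X X'"
    using \<phi>_mult by (intro homI) (auto simp: X X' \<phi>_def)
  have \<psi>: "\<psi> x \<in> carrier X" "\<phi> (\<psi> x) = x" if "x \<in> carrier X'" for x
    using that by (auto simp: X X' \<phi>_def \<psi>_def)
  have \<psi>\<phi>: "\<psi> (\<phi> x) = x" for x by (cases x) (simp add: \<phi>_def \<psi>_def)
  have "\<phi> \<in> iso X X'"
    using \<phi>_hom \<psi> \<psi>\<phi> hom_in_carrier[OF \<phi>_hom]
    unfolding iso_def by (auto intro!: bij_betwI[of _ _ _ \<psi>])
  \<comment> \<open>Transport of structure along \<open>\<phi>\<close> gives the group axioms of \<open>X'\<close> at once.\<close>
  moreover have "X'\<lparr>one := \<phi> \<one>\<^bsub>X\<^esub>\<rparr> = X'"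
    by (simp add: X'_def \<phi>_def X_def L_def semidirect_def)
  ultimately have X'_group: "group X'" using B.G.iso_imp_img_group by metis
  have \<psi>_hom: "\<psi> \<in> hom X' X"
  proof (rule homI)
    fix x y assume xy: "x \<in> carrier X'" "y \<in> carrier X'"
    have "\<phi> (\<psi> x \<otimes>\<^bsub>X\<^esub> \<psi> y) = x \<otimes>\<^bsub>X'\<^esub> y" using \<phi>_mult \<psi> xy by simp
    then show "\<psi> (x \<otimes>\<^bsub>X'\<^esub> y) = \<psi> x \<otimes>\<^bsub>X\<^esub> \<psi> y" using \<psi>\<phi> by metis
  qed (rule \<psi>)
  have star: "splitting (derivation_star d' d) = \<phi> \<circ> (splitting d' \<circ> splitting d)"
    by (auto simp: splitting_def derivation_star_def \<phi>_def)
  have s_hom: "splitting d' \<circ> splitting d \<in> hom G X"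
    by (rule hom_compose[OF A.s B.s])
  have p_hom: "snd \<circ> snd \<in> hom X G"
    by (rule hom_compose[OF B.p A.p])
  have C: "split_projection X G (snd \<circ> snd) (splitting d' \<circ> splitting d)"
    by (intro split_projection.intro split_projection_axioms.intro B.G.discrete_group_axioms
        A.Q.discrete_group_axioms p_hom s_hom) (simp add: splitting_def)
  have D: "split_projection X' G snd (splitting (derivation_star d' d))"
  proof (intro split_projection.intro split_projection_axioms.intro discrete_group.intro X'_group assms(1))
    have "snd = (snd \<circ> snd) \<circ> \<psi>" by (auto simp: \<psi>_def)
    then show "snd \<in> hom X' G" using hom_compose[OF \<psi>_hom p_hom] by simp
    show "splitting (derivation_star d' d) \<in> hom G X'"
      unfolding star by (rule hom_compose[OF s_hom \<phi>_hom])
  qed (simp add: splitting_def)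
  have D': "parametrized_cat (classifying_space X) (classifying_map G (snd \<circ> snd)) (classifying_map X (splitting d' \<circ> splitting d))
      \<le> parametrized_cat (classifying_space X') (classifying_map G snd) (classifying_map X' (splitting (derivation_star d' d)))"
    using \<psi>\<phi> by (intro parametrized_cat_retract_le[OF C D \<phi>_hom \<psi>_hom]) (auto simp: \<phi>_def \<psi>_def star)
  have "parametrized_cat (classifying_space L) (classifying_map G snd) (classifying_map L (splitting d))
      \<le> parametrized_cat (classifying_space X) (classifying_map G (snd \<circ> snd)) (classifying_map X (splitting d' \<circ> splitting d))"
    by (intro parametrized_cat_retract_le[OF A.split_projection_axioms C B.s B.p]) (auto simp: splitting_def)
  moreover have "parametrized_cat (classifying_space X) (classifying_map L snd) (classifying_map X (splitting d'))
      \<le> parametrized_cat (classifying_space X) (classifying_map G (snd \<circ> snd)) (classifying_map X (splitting d' \<circ> splitting d))"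
    by (rule parametrized_cat_tower_le[OF B.split_projection_axioms C A.s])
  ultimately show ?thesis
    using D' unfolding tc_def L_def[symmetric] X_def[symmetric] X'_def[symmetric]
    by (auto intro: order_trans)
qed

end
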